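(* Let $d\ge 0$ be an integer and let $M$ be a binary $(2,2)$-matrix. The problem $d$-$SC1S$-$R$ on input $\langle M,d\rangle$ — deciding whether there is a set $R'$ of rows of $M$ with $|R'|\le d$ such that the matrix obtained from $M$ by deleting the rows in $R'$ has the simultaneous consecutive ones property — is solvable in polynomial time.
   Context: A binary matrix has the consecutive ones property (C1P) for rows if its columns can be permuted so that in every row the $1$-entries occur consecutively; it has the C1P for columns if its rows can be permuted so that in every column the $1$-entries occur consecutively. It has the simultaneous consecutive ones property (SC1P) if it has both the C1P for rows and the C1P for columns. An $(x,y)$-matrix is a binary matrix with at most $x$ ones in each column and at most $y$ ones in each row. *)

theory Defs
  imports
    "Jordan_Normal_Form.DL_Submatrix"
    "HOL-Combinatorics.Permutations"
    "HOL-Computational_Algebra.Polynomial"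
begin

section \<open>Binary matrices and the simultaneous consecutive ones property\<close>

definition binary_mat :: "nat mat \<Rightarrow> bool" where
  "binary_mat M \<longleftrightarrow> elements_mat M \<subseteq> {0, 1}"

definition xy_matrix :: "nat \<Rightarrow> nat \<Rightarrow> nat mat \<Rightarrow> bool" where
  "xy_matrix x y M \<longleftrightarrow> binary_mat M \<and>
     (\<forall>j<dim_col M. card {i. i < dim_row M \<and> M $$ (i, j) = 1} \<le> x) \<and>
     (\<forall>i<dim_row M. card {j. j < dim_col M \<and> M $$ (i, j) = 1} \<le> y)"

definition consecutive_ones :: "nat vec \<Rightarrow> bool" where
  "consecutive_ones v \<longleftrightarrow>
     (\<forall>i j k. i < j \<and> j < k \<and> k < dim_vec v \<and> v $ i = 1 \<and> v $ k = 1 \<longrightarrow> v $ j = 1)"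

definition permute_cols :: "(nat \<Rightarrow> nat) \<Rightarrow> 'a mat \<Rightarrow> 'a mat" where
  "permute_cols \<pi> M = mat (dim_row M) (dim_col M) (\<lambda>(i, j). M $$ (i, \<pi> j))"

definition permute_rows :: "(nat \<Rightarrow> nat) \<Rightarrow> 'a mat \<Rightarrow> 'a mat" where
  "permute_rows \<pi> M = mat (dim_row M) (dim_col M) (\<lambda>(i, j). M $$ (\<pi> i, j))"

definition C1P_rows :: "nat mat \<Rightarrow> bool" where
  "C1P_rows M \<longleftrightarrow> (\<exists>\<pi>. \<pi> permutes {..<dim_col M} \<and>
     (\<forall>i<dim_row M. consecutive_ones (row (permute_cols \<pi> M) i)))"

definition C1P_cols :: "nat mat \<Rightarrow> bool" where
  "C1P_cols M \<longleftrightarrow> (\<exists>\<pi>. \<pi> permutes {..<dim_row M} \<and>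
     (\<forall>j<dim_col M. consecutive_ones (col (permute_rows \<pi> M) j)))"

definition SC1P :: "nat mat \<Rightarrow> bool" where
  "SC1P M \<longleftrightarrow> C1P_rows M \<and> C1P_cols M"

definition delete_rows :: "nat set \<Rightarrow> 'a mat \<Rightarrow> 'a mat" where
  "delete_rows R M = submatrix M (- R) UNIV"

definition SC1S_R :: "nat \<Rightarrow> nat mat \<Rightarrow> bool" where
  "SC1S_R d M \<longleftrightarrow> (\<exists>R \<subseteq> {..<dim_row M}. card R \<le> d \<and> SC1P (delete_rows R M))"


section \<open>Deterministic multi-tape Turing machines\<close>

text \<open>
  States and tape symbols are initial segments of the natural numbers. Symbol 0 is the blank,
  1 the left end marker, and 2 and 3 are the input symbols for the bits 0 and 1. The tapes are
  infinite to the right only; the head of a tape is at first on the marker in cell 0, and a move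
  to the left in cell 0 has no effect.
\<close>

datatype direction = MoveLeft | Stay | MoveRight

record tm =
  num_tapes :: nat
  num_symbols :: nat
  num_states :: nat
  start_state :: nat
  accept_state :: nat
  reject_state :: nat
  delta :: "nat \<Rightarrow> nat list \<Rightarrow> nat \<times> (nat \<times> direction) list"

definition wf_tm :: "tm \<Rightarrow> bool" where
  "wf_tm T \<longleftrightarrow>
     num_tapes T \<ge> 1 \<and> num_symbols T \<ge> 4 \<and>
     start_state T < num_states T \<and> accept_state T < num_states T \<and>
     reject_state T < num_states T \<and> accept_state T \<noteq> reject_state T \<and>
     (\<forall>q syms. q < num_states T \<and> length syms = num_tapes T \<and> set syms \<subseteq> {..<num_symbols T} \<longrightarrow>
        (case delta T q syms of (q', acts) \<Rightarrow>
           q' < num_states T \<and> length acts = num_tapes T \<and> fst ` set acts \<subseteq> {..<num_symbols T}))"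

type_synonym tape = "(nat \<Rightarrow> nat) \<times> nat"

type_synonym config = "nat \<times> tape list"

fun read_tape :: "tape \<Rightarrow> nat" where
  "read_tape (c, h) = c h"

fun move_head :: "direction \<Rightarrow> nat \<Rightarrow> nat" where
  "move_head MoveLeft h = h - 1"
| "move_head Stay h = h"
| "move_head MoveRight h = h + 1"

fun act_tape :: "nat \<times> direction \<Rightarrow> tape \<Rightarrow> tape" where
  "act_tape (s, dir) (c, h) = (c(h := s), move_head dir h)"

definition tm_step :: "tm \<Rightarrow> config \<Rightarrow> config" where
  "tm_step T = (\<lambda>(q, tps).
     if q = accept_state T \<or> q = reject_state T then (q, tps)
     else (case delta T q (map read_tape tps) of (q', acts) \<Rightarrow> (q', map2 act_tape acts tps)))"

definition blank_tape :: tape where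
  "blank_tape = ((\<lambda>i. if i = 0 then 1 else 0), 0)"

definition input_tape :: "bool list \<Rightarrow> tape" where
  "input_tape w =
     ((\<lambda>i. if i = 0 then 1 else if i \<le> length w then (if w ! (i - 1) then 3 else 2) else 0), 0)"

definition init_config :: "tm \<Rightarrow> bool list \<Rightarrow> config" where
  "init_config T w = (start_state T, input_tape w # replicate (num_tapes T - 1) blank_tape)"

definition accepts_within :: "tm \<Rightarrow> bool list \<Rightarrow> nat \<Rightarrow> bool" where
  "accepts_within T w t \<longleftrightarrow> (\<exists>n\<le>t. fst ((tm_step T ^^ n) (init_config T w)) = accept_state T)"

definition rejects_within :: "tm \<Rightarrow> bool list \<Rightarrow> nat \<Rightarrow> bool" where
  "rejects_within T w t \<longleftrightarrow> (\<exists>n\<le>t. fst ((tm_step T ^^ n) (init_config T w)) = reject_state T)"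

text \<open>
  A problem is given by its set \<open>I\<close> of instances, the encoding of instances as bit strings and
  the set of instances with answer yes. Nothing is required on bit strings that do not encode an
  instance.
\<close>

definition poly_time_solvable :: "'a set \<Rightarrow> ('a \<Rightarrow> bool list) \<Rightarrow> ('a \<Rightarrow> bool) \<Rightarrow> bool" where
  "poly_time_solvable I enc yes \<longleftrightarrow>
     (\<exists>T (p :: nat poly). wf_tm T \<and>
        (\<forall>x\<in>I. if yes x then accepts_within T (enc x) (poly p (length (enc x)))
                else rejects_within T (enc x) (poly p (length (enc x)))))"


section \<open>Encoding of instances\<close>

text \<open>Binary representation, least significant bit first, without leading zeros.\<close>

fun binary :: "nat \<Rightarrow> bool list" where
  "binary n = (if n = 0 then [] else odd n # binary (n div 2))"

declare binary.simps [simp del]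

text \<open>
  The two dimensions in unary, each closed by a zero bit, then the entries row by row, then the
  number \<open>d\<close> in binary. If both dimensions are positive, the unary numbers are at most as long as
  the list of entries, up to a constant factor.
\<close>

definition encode_mat :: "nat mat \<Rightarrow> bool list" where
  "encode_mat M =
     replicate (dim_row M) True @ [False] @ replicate (dim_col M) True @ [False] @
     concat (map (\<lambda>i. map (\<lambda>j. M $$ (i, j) = 1) [0..<dim_col M]) [0..<dim_row M])"

definition encode_instance :: "nat mat \<times> nat \<Rightarrow> bool list" where
  "encode_instance = (\<lambda>(M, d). encode_mat M @ binary d)"

lemma binary_inject: "binary m = binary n \<longleftrightarrow> m = n"
proof
  show "binary m = binary n \<Longrightarrow> m = n"
  proof (induction m arbitrary: n rule: less_induct)
    case (less m)
    show ?case
    proof (cases "m = 0 \<or> n = 0")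
      case True
      then show ?thesis
        using less.prems binary.simps [of m] binary.simps [of n] by (metis list.distinct(1))
    next
      case False
      then have "odd m = odd n" and "binary (m div 2) = binary (n div 2)"
        using less.prems binary.simps [of m] binary.simps [of n] by (auto split: if_splits)
      moreover from this have "m div 2 = n div 2"
        using less.IH [of "m div 2" "n div 2"] False by simp
      ultimately show ?thesis
        by presburger
    qed
  qed
qed simp

lemma replicate_append_inject:
  "replicate m True @ False # xs = replicate n True @ False # ys \<longleftrightarrow> m = n \<and> xs = ys"
proof (induction m arbitrary: n)
  case 0
  show ?case by (cases n) auto
next
  case (Suc m)
  then show ?case by (cases n) auto
qed

lemma encode_instance_inj:
  "inj_on encode_instance {(M, d). binary_mat M}"
proof (rule inj_onI, clarsimp)
  fix M M' :: "nat mat" and d d'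
  assume bin: "binary_mat M" "binary_mat M'"
    and eq: "encode_instance (M, d) = encode_instance (M', d')"
  define E where
    "E = (\<lambda>A :: nat mat. concat (map (\<lambda>i. map (\<lambda>j. A $$ (i, j) = 1) [0..<dim_col A]) [0..<dim_row A]))"
  have dims: "dim_row M = dim_row M'" "dim_col M = dim_col M'"
    and "E M @ binary d = E M' @ binary d'"
    using eq by (auto simp: encode_instance_def encode_mat_def E_def replicate_append_inject)
  moreover have "length (E A) = dim_row A * dim_col A" for A
    by (simp add: E_def length_concat o_def sum_list_triv)
  ultimately have entries: "E M = E M'" and "binary d = binary d'"
    by auto
  have "map (\<lambda>i. map (\<lambda>j. M $$ (i, j) = 1) [0..<dim_col M]) [0..<dim_row M] =
        map (\<lambda>i. map (\<lambda>j. M' $$ (i, j) = 1) [0..<dim_col M]) [0..<dim_row M]"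
    by (rule concat_injective) (use entries dims in \<open>auto simp: E_def set_zip\<close>)
  then have *: "(M $$ (i, j) = 1) = (M' $$ (i, j) = 1)" if "i < dim_row M" "j < dim_col M" for i j
    using that by (auto simp: list_eq_iff_nth_eq)
  have "A $$ (i, j) \<in> {0, 1}" if "binary_mat A" "i < dim_row A" "j < dim_col A" for A i j
    using that unfolding binary_mat_def by (meson carrier_matI elements_matI subsetD)
  then have "M $$ (i, j) = M' $$ (i, j)" if "i < dim_row M'" "j < dim_col M'" for i j
    using * [of i j] dims bin that by (metis insertE singletonD)
  then have "M = M'"
    using dims by (intro eq_matI) auto
  with \<open>binary d = binary d'\<close> show "M = M' \<and> d = d'"
    by (simp add: binary_inject)
qed

end

theory Submission
  imports Defs
begin

text \<open>
  Call two rows adjacent if they have a one in a common column. For a (2,2)-matrix this graph has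
  maximum degree two, and a matrix with at most two ones per column has the SC1P exactly if its rows
  can be listed with adjacent rows next to each other, that is, if the graph has no cycle. Hence the
  least number of rows to delete is the number of cycles, and a cycle is counted at its least row
  \<open>i\<close>: these are the rows from which a walk that never turns back can make as many steps as there
  are rows without getting stuck and without visiting a row below \<open>i\<close>.

  This count needs only finitely many counters bounded by the input length. A Turing machine that
  never writes holds a counter as the position of a head, so a program with such counters has only
  polynomially many configurations. As it is deterministic, it halts within that many steps if it
  halts at all, and no running time has to be computed.
\<close>

section \<open>Linear forests among graphs of maximum degree two\<close>

text \<open>Cycles enter through their vertex sets: a set in which every vertex has exactly two
  neighbours, both inside, needs no chosen order of traversal. Such sets behave well under the
  operations required. The least one through a vertex is an intersection, two least ones can be
  subtracted from each other, and passing to an induced subgraph keeps exactly those that avoid the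
  deleted vertices. Disjointness of the least ones gives the lower bound on deletions; the set of
  least vertices itself is a deletion set attaining it.

  Both bounds of a (2,2)-matrix are needed for degree two: a row has at most two ones, and each of
  their columns contains at most one other row. The row half of the SC1P then comes for free, since
  the columns can be sorted along any good order of the rows.

  The number \<open>d\<close> is the obstacle on the machine side. In binary it may be exponential
  in the input length, beyond the reach of any counter, so it is never loaded. Instead the cycle
  count is halved in step with the bits of \<open>d\<close>, least significant first, and only a
  flag is carried along.\<close>

text \<open>In a graph of maximum degree two, the cores are the vertex sets of nonempty unions of cycles.\<close>

definition core :: "('a \<Rightarrow> 'a \<Rightarrow> bool) \<Rightarrow> 'a set \<Rightarrow> bool" where
  "core E S \<longleftrightarrow> S \<noteq> {} \<and> finite S \<and> (\<forall>x\<in>S. card {y. E x y} = 2 \<and> {y. E x y} \<subseteq> S)"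

lemma core_neighbour:
  assumes "core E S" "x \<in> S"
  obtains y where "E x y"
proof -
  have "card {y. E x y} = 2" using assms by (simp add: core_def)
  then have "{y. E x y} \<noteq> {}" by (metis card.empty zero_neq_numeral)
  then show ?thesis using that by blast
qed

text \<open>At the least position occupied by \<open>S\<close>, both neighbours would have to sit at
  the next position, where injectivity leaves room for one.\<close>

lemma no_core_of_positions:
  fixes pos :: "'a \<Rightarrow> nat"
  assumes "inj_on pos S"
    and adj: "\<And>x y. x \<in> S \<Longrightarrow> E x y \<Longrightarrow> pos y = Suc (pos x) \<or> pos x = Suc (pos y)"
  shows "\<not> core E S"
proof
  assume core: "core E S"
  then obtain x where x: "x \<in> S" and least: "\<And>y. y \<in> S \<Longrightarrow> pos x \<le> pos y"
    using ex_min_if_finite[of "pos ` S"] by (auto simp: core_def not_less)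
  have sub: "{y. E x y} \<subseteq> S" and card: "card {y. E x y} = 2"
    using core x by (auto simp: core_def)
  have "pos y = Suc (pos x)" if "E x y" for y
    using adj[OF x that] least[of y] sub that by auto
  then have "pos ` {y. E x y} \<subseteq> {Suc (pos x)}" by auto
  then have "card (pos ` {y. E x y}) \<le> card {Suc (pos x)}"
    by (intro card_mono) auto
  moreover have "card (pos ` {y. E x y}) = 2"
    using card card_image inj_on_subset[OF assms(1) sub] by metis
  ultimately show False by simp
qed

definition consec :: "'a list \<Rightarrow> 'a \<Rightarrow> 'a \<Rightarrow> bool" where
  "consec xs x y \<longleftrightarrow> (\<exists>as bs. xs = as @ x # y # bs)"

text \<open>An insertion can separate only the pair across the gap. When a vertex is put back into
  an arrangement, only this pair must be shown not to be an edge.\<close>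

lemma consec_insert:
  assumes "consec (ps @ qs) x y"
  shows "consec (ps @ v # qs) x y \<or> (ps \<noteq> [] \<and> qs \<noteq> [] \<and> x = last ps \<and> y = hd qs)"
proof -
  from assms obtain as bs where eq: "ps @ qs = as @ x # y # bs"
    by (auto simp: consec_def)
  then consider us where "ps = as @ us" "us @ qs = x # y # bs"
    | us where "as = ps @ us" "qs = us @ x # y # bs"
    by (auto simp: append_eq_append_conv2)
  then show ?thesis
  proof cases
    case 1
    show ?thesis
    proof (cases us)
      case Nil
      with 1 have "ps @ v # qs = (as @ [v]) @ x # y # bs" by simp
      then show ?thesis unfolding consec_def by blast
    next
      case (Cons u us')
      note us = this
      show ?thesis
      proof (cases us')
        case Nil
        with 1 us show ?thesis by auto
      next
        case (Cons u' us'')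
        with 1 us have "ps @ v # qs = as @ x # y # (us'' @ v # qs)" by simp
        then show ?thesis unfolding consec_def by blast
      qed
    qed
  next
    case 2
    then have "ps @ v # qs = (ps @ v # us) @ x # y # bs" by simp
    then show ?thesis unfolding consec_def by blast
  qed
qed

lemma consec_nth:
  assumes "consec xs x y"
  shows "\<exists>i. Suc i < length xs \<and> xs ! i = x \<and> xs ! Suc i = y"
proof -
  from assms obtain as bs where "xs = as @ x # y # bs" by (auto simp: consec_def)
  then show ?thesis by (intro exI[of _ "length as"]) (auto simp: nth_append)
qed

text \<open>
  A vertex of degree at most one is removed and put back beside its neighbour, on the side where
  the neighbour has no other neighbour.
\<close>

lemma linear_arrangement:
  fixes E :: "'a \<Rightarrow> 'a \<Rightarrow> bool"
  assumes "finite V" and "\<And>x y. E x y \<Longrightarrow> E y x" and "\<And>x. \<not> E x x"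
    and "\<And>x y. E x y \<Longrightarrow> x \<in> V" and "\<And>x. card {y. E x y} \<le> 2" and "\<And>S. \<not> core E S"
  shows "\<exists>xs. distinct xs \<and> set xs = V \<and> (\<forall>x y. E x y \<longrightarrow> consec xs x y \<or> consec xs y x)"
  using assms
proof (induction V arbitrary: E rule: finite_psubset_induct)
  case (psubset V)
  note sym = psubset.prems(1) and irr = psubset.prems(2) and inV = psubset.prems(3)
    and deg = psubset.prems(4) and nocore = psubset.prems(5)
  have nbV: "{y. E x y} \<subseteq> V" for x using inV sym by blast
  have fin: "finite {y. E x y}" for x using nbV psubset.hyps(1) finite_subset by metis
  show ?case
  proof (cases "V = {}")
    case True
    then show ?thesis using inV by (intro exI[of _ "[]"]) auto
  next
    case False
    \<comment> \<open>\<open>V\<close> is finite, nonempty and closed under adjacency, so it can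
      fail to be a core only through a vertex whose degree is not two.\<close>
    with nocore[of V] psubset.hyps(1) nbV obtain v where v: "v \<in> V" and "card {y. E v y} \<noteq> 2"
      by (auto simp: core_def)
    with deg[of v] have degv: "card {y. E v y} \<le> 1" by simp
    define E' where "E' = (\<lambda>x y. E x y \<and> x \<noteq> v \<and> y \<noteq> v)"
    have le: "card {y. E' x y} \<le> card {y. E x y}" for x
      by (rule card_mono[OF fin]) (auto simp: E'_def)
    \<comment> \<open>Deleting \<open>v\<close> creates no core: a vertex with two neighbours left
      in \<open>E'\<close> has exactly these two in \<open>E\<close>, by the degree bound.\<close>
    have nocore': "\<not> core E' S" for S
    proof
      assume core': "core E' S"
      have "{y. E x y} = {y. E' x y}" if "x \<in> S" for x
      proof (rule card_seteq[symmetric])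
        show "{y. E' x y} \<subseteq> {y. E x y}" by (auto simp: E'_def)
        show "card {y. E x y} \<le> card {y. E' x y}"
          using core' that deg[of x] by (auto simp: core_def)
      qed (rule fin)
      then have "core E S" using core' by (auto simp: core_def)
      with nocore show False by blast
    qed
    have "V - {v} \<subset> V" using v by blast
    then have "\<exists>xs. distinct xs \<and> set xs = V - {v} \<and>
      (\<forall>x y. E' x y \<longrightarrow> consec xs x y \<or> consec xs y x)"
    proof (rule psubset.IH)
      show "card {y. E' x y} \<le> 2" for x using le[of x] deg[of x] by linarith
    qed (use sym irr inV nocore' in \<open>auto simp: E'_def\<close>)
    then obtain xs where
      xs: "distinct xs" "set xs = V - {v}" "\<And>x y. E' x y \<Longrightarrow> consec xs x y \<or> consec xs y x"
      by blast
    show ?thesis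
    proof (cases "{y. E v y} = {}")
      case True
      have "consec (v # xs) x y \<or> consec (v # xs) y x" if "E x y" for x y
      proof -
        have "E' x y" using that True sym by (auto simp: E'_def)
        then show ?thesis
          using xs(3)[of x y] consec_insert[of "[]" xs _ _ v] by auto
      qed
      then show ?thesis using xs v by (intro exI[of _ "v # xs"]) auto
    next
      case False
      with degv fin[of v] obtain u where u: "{y. E v y} = {u}"
        by (metis One_nat_def card_0_eq card_1_singletonE le_SucE le_zero_eq)
      then have Evu: "E v u" "E u v" using sym by auto
      then have "u \<in> set xs" using xs(2) inV irr by auto
      then obtain ys zs where split: "xs = ys @ u # zs" by (meson split_list)
      have new: "E x y \<Longrightarrow> E' x y \<or> (x = v \<and> y = u) \<or> (x = u \<and> y = v)" for x y
        using u sym by (auto simp: E'_def)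
      \<comment> \<open>\<open>v\<close> takes one of the two neighbours that \<open>u\<close> may
        have. At most one is left in \<open>E'\<close>, so on at least one side of \<open>u\<close>
        the place next to it can be given to \<open>v\<close>.\<close>
      have one: "a = b" if "E' u a" "E' u b" for a b
      proof (rule ccontr)
        assume "a \<noteq> b"
        with that have "card {v, a, b} = 3" by (auto simp: E'_def)
        moreover have "{v, a, b} \<subseteq> {y. E u y}" using that Evu by (auto simp: E'_def)
        then have "card {v, a, b} \<le> card {y. E u y}" by (rule card_mono[OF fin])
        ultimately show False using deg[of u] by linarith
      qed
      show ?thesis
      proof (cases "ys \<noteq> [] \<and> E' u (last ys)")
        case True
        let ?xs = "(ys @ [u]) @ v # zs"
        have "consec ?xs x y \<or> consec ?xs y x" if "E x y" for x y
          using new[OF that]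
        proof (elim disjE)
          assume e: "E' x y"
          have no: "\<not> (zs \<noteq> [] \<and> E' u (hd zs))"
            using one[of "last ys" "hd zs"] True xs(1) split
            by (auto dest: last_in_set hd_in_set)
          have "E' y x" using e sym by (auto simp: E'_def)
          with e no have "\<not> (zs \<noteq> [] \<and> x = u \<and> y = hd zs)" "\<not> (zs \<noteq> [] \<and> y = u \<and> x = hd zs)"
            by auto
          moreover have "consec ((ys @ [u]) @ zs) x y \<or> consec ((ys @ [u]) @ zs) y x"
            using xs(3)[OF e] split by simp
          ultimately show ?thesis
            using consec_insert[of "ys @ [u]" zs x y v] consec_insert[of "ys @ [u]" zs y x v]
            by (metis last_snoc)
        qed (auto simp: consec_def)
        then show ?thesis using xs v split
          by (intro exI[of _ ?xs]) auto
      next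
        case False
        let ?xs = "ys @ v # u # zs"
        have "consec ?xs x y \<or> consec ?xs y x" if "E x y" for x y
          using new[OF that]
        proof (elim disjE)
          assume e: "E' x y"
          have "E' y x" using e sym by (auto simp: E'_def)
          with e False have "\<not> (ys \<noteq> [] \<and> x = u \<and> y = last ys)" "\<not> (ys \<noteq> [] \<and> y = u \<and> x = last ys)"
            by auto
          moreover have "consec (ys @ u # zs) x y \<or> consec (ys @ u # zs) y x"
            using xs(3)[OF e] split by simp
          ultimately show ?thesis
            using consec_insert[of ys "u # zs" x y v] consec_insert[of ys "u # zs" y x v]
            by (metis list.sel(1))
        qed (auto simp: consec_def)
        then show ?thesis using xs v split
          by (intro exI[of _ ?xs]) auto
      qed
    qed
  qed
qed

section \<open>Counting cycles by their least vertices\<close>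

text \<open>\<open>S\<close> may be a union of several cycles. Its least element is then also the
  least vertex of its own cycle, so no minimality of \<open>S\<close> has to be demanded.\<close>

definition core_minima :: "(nat \<Rightarrow> nat \<Rightarrow> bool) \<Rightarrow> nat set" where
  "core_minima E = {i. \<exists>S. core E S \<and> i \<in> S \<and> (\<forall>x\<in>S. i \<le> x)}"

lemma core_meets_core_minima: "core E S \<Longrightarrow> S \<inter> core_minima E \<noteq> {}"
proof -
  assume core: "core E S"
  then have "Min S \<in> S" "\<forall>x\<in>S. Min S \<le> x" by (auto simp: core_def)
  with core show ?thesis unfolding core_minima_def by blast
qed

text \<open>The least cores through different core minima are disjoint, and \<open>R\<close> must
  meet each of them, so a choice of meeting points is injective.\<close>

lemma card_core_minima_le:
  assumes sym: "\<And>x y. E x y \<Longrightarrow> E y x" and "finite R"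
    and meets: "\<And>S. core E S \<Longrightarrow> S \<inter> R \<noteq> {}"
  shows "card (core_minima E) \<le> card R"
proof -
  define K where "K i = \<Inter>{S. core E S \<and> i \<in> S}" for i
  have K: "core E (K i)" "i \<in> K i" "\<forall>x\<in>K i. i \<le> x" if "i \<in> core_minima E" for i
  proof -
    from that obtain S where S: "core E S" "i \<in> S" "\<forall>x\<in>S. i \<le> x"
      by (auto simp: core_minima_def)
    then have "K i \<subseteq> S" by (auto simp: K_def)
    then show "\<forall>x\<in>K i. i \<le> x" using S by auto
    show "i \<in> K i" by (auto simp: K_def)
    show "core E (K i)"
      unfolding core_def
    proof (intro conjI ballI)
      show "K i \<noteq> {}" using \<open>i \<in> K i\<close> by auto
      show "finite (K i)" using S \<open>K i \<subseteq> S\<close> by (auto simp: core_def intro: finite_subset)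
    next
      fix x assume x: "x \<in> K i"
      then show "card {y. E x y} = 2" using S \<open>K i \<subseteq> S\<close> by (auto simp: core_def)
      show "{y. E x y} \<subseteq> K i" using x by (auto simp: K_def core_def)
    qed
  qed
  have disj: "K i \<inter> K i' = {}" if "i \<in> core_minima E" "i' \<in> core_minima E" "i < i'" for i i'
  proof -
    have "i \<notin> K i'" using K(3)[OF that(2)] that(3) by auto
    \<comment> \<open>No edge leaves \<open>K i'\<close>, and by symmetry none enters it, so
      subtracting it preserves closure. The difference still contains \<open>i\<close>, and
      leastness of \<open>K i\<close> then forces disjointness.\<close>
    have "core E (K i - K i')"
      unfolding core_def
    proof (intro conjI ballI)
      show "K i - K i' \<noteq> {}" using K(2)[OF that(1)] \<open>i \<notin> K i'\<close> by auto
      show "finite (K i - K i')" using K(1)[OF that(1)] by (auto simp: core_def)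
    next
      fix x assume x: "x \<in> K i - K i'"
      then show "card {y. E x y} = 2" using K(1)[OF that(1)] by (auto simp: core_def)
      show "{y. E x y} \<subseteq> K i - K i'"
        using x K(1)[OF that(1)] K(1)[OF that(2)] sym unfolding core_def by blast
    qed
    then have "K i \<subseteq> K i - K i'"
      using K(2)[OF that(1)] \<open>i \<notin> K i'\<close> by (auto simp: K_def)
    then show ?thesis by auto
  qed
  define g where "g i = (SOME x. x \<in> K i \<inter> R)" for i
  have g: "g i \<in> K i \<inter> R" if "i \<in> core_minima E" for i
    unfolding g_def using meets[OF K(1)[OF that]] by (meson all_not_in_conv someI_ex)
  have "inj_on g (core_minima E)"
  proof (rule inj_onI)
    fix i i' assume *: "i \<in> core_minima E" "i' \<in> core_minima E" "g i = g i'"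
    then have "K i \<inter> K i' \<noteq> {}" using g by (metis IntD1 IntI empty_iff)
    then show "i = i'" using disj[of i i'] disj[of i' i] * by (metis Int_commute linorder_neqE_nat)
  qed
  then show ?thesis using g \<open>finite R\<close> by (intro card_inj_on_le[of g]) auto
qed

lemma core_minima_subset: "(\<And>x y. E x y \<Longrightarrow> x \<in> V) \<Longrightarrow> core_minima E \<subseteq> V"
proof
  fix i assume "\<And>x y. E x y \<Longrightarrow> x \<in> V" and "i \<in> core_minima E"
  then show "i \<in> V" unfolding core_minima_def by (blast elim: core_neighbour)
qed

text \<open>A vertex in a core of the induced graph keeps two neighbours there. As it never had
  more, it has lost none, so the neighbourhoods coincide.\<close>

lemma core_induced:
  assumes "\<And>x. card {y. E x y} \<le> 2" and fin: "\<And>x. finite {y. E x y}"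
  shows "core (\<lambda>x y. E x y \<and> x \<notin> R \<and> y \<notin> R) S \<longleftrightarrow> core E S \<and> S \<inter> R = {}"
proof
  let ?E = "\<lambda>x y. E x y \<and> x \<notin> R \<and> y \<notin> R"
  assume core: "core ?E S"
  have eq: "{y. E x y} = {y. ?E x y}" if "x \<in> S" for x
  proof (rule card_seteq[symmetric])
    show "card {y. E x y} \<le> card {y. ?E x y}"
      using core that assms(1)[of x] by (auto simp: core_def)
  qed (use fin in auto)
  have "x \<notin> R" if "x \<in> S" for x
  proof
    assume "x \<in> R"
    then have "card {y. ?E x y} = 0" by simp
    then show False using core that by (auto simp: core_def)
  qed
  then show "core E S \<and> S \<inter> R = {}" using core eq by (auto simp: core_def)
next
  let ?E = "\<lambda>x y. E x y \<and> x \<notin> R \<and> y \<notin> R"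
  assume *: "core E S \<and> S \<inter> R = {}"
  then have "{y. ?E x y} = {y. E x y}" if "x \<in> S" for x
    using that by (auto simp: core_def)
  then show "core ?E S" using * by (auto simp: core_def)
qed

section \<open>Walks that never turn back\<close>

definition walk :: "('a \<Rightarrow> 'a \<Rightarrow> bool) \<Rightarrow> (nat \<Rightarrow> 'a) \<Rightarrow> nat \<Rightarrow> bool" where
  "walk E w n \<longleftrightarrow> (\<forall>k<n. E (w k) (w (Suc k))) \<and> (\<forall>k. Suc k < n \<longrightarrow> w (Suc (Suc k)) \<noteq> w k)"

lemma walk_in_core: "walk E w n \<Longrightarrow> core E S \<Longrightarrow> w 0 \<in> S \<Longrightarrow> k \<le> n \<Longrightarrow> w k \<in> S"
proof (induction k)
  case (Suc k)
  then have "w k \<in> S" "E (w k) (w (Suc k))" by (auto simp: walk_def)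
  then show ?case using Suc.prems by (auto simp: core_def)
qed simp

text \<open>
  The first vertex that a walk visits twice is its first vertex: the predecessor on the second
  visit would be one of the two neighbours used on the first visit.
\<close>

lemma long_walk_core:
  assumes "finite V" and sym: "\<And>x y. E x y \<Longrightarrow> E y x" and irr: "\<And>x. \<not> E x x"
    and inV: "\<And>x y. E x y \<Longrightarrow> x \<in> V" and deg: "\<And>x. card {y. E x y} \<le> 2"
    and walk: "walk E w n" and n: "card V \<le> n" "0 < n"
  shows "\<exists>S. core E S \<and> w 0 \<in> S \<and> S \<subseteq> w ` {..n}"
proof -
  have fin: "finite {y. E x y}" for x
    by (rule finite_subset[OF _ \<open>finite V\<close>]) (use inV sym in blast)
  have step: "E (w k) (w (Suc k))" if "k < n" for k using walk that by (auto simp: walk_def)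
  have noback: "w (Suc (Suc k)) \<noteq> w k" if "Suc k < n" for k using walk that by (auto simp: walk_def)
  have "w k \<in> V" if "k \<le> n" for k
  proof (cases k)
    case 0
    then show ?thesis using step[of 0] inV n by auto
  next
    case (Suc m)
    then show ?thesis using step[of m] that sym inV by auto
  qed
  then have "w ` {..n} \<subseteq> V" by auto
  then have "card (w ` {..n}) < card {..n}"
    using card_mono[OF \<open>finite V\<close>, of "w ` {..n}"] n by simp
  \<comment> \<open>A walk of \<open>n\<close> steps visits \<open>n + 1\<close> places, one more
    than the number of vertices available.\<close>
  then have "\<not> inj_on w {..n}" by (rule pigeonhole)
  then have "\<exists>b a. b \<le> n \<and> a < b \<and> w a = w b"
    by (auto simp: inj_on_def) (metis linorder_neqE_nat)
  then have "\<exists>b. b \<le> n \<and> (\<exists>a<b. w a = w b)" by blast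
  from exists_least_iff[THEN iffD1, OF this]
  obtain b a where b: "b \<le> n" and a: "a < b" "w a = w b"
    and least: "\<And>b'. b' < b \<Longrightarrow> \<not> (b' \<le> n \<and> (\<exists>a<b'. w a = w b'))"
    by blast
  have distinct: "x = y" if "x < b" "y < b" "w x = w y" for x y
    using least[of x] least[of y] that b by (metis le_trans less_imp_le linorder_neqE_nat)
  \<comment> \<open>Returns after one or two steps are excluded by irreflexivity and by never
    turning back. The closed part thus has length at least three, which makes predecessor and
    successor on it different.\<close>
  have "b \<noteq> Suc a" using step[of a] a b irr by auto
  moreover have "b \<noteq> Suc (Suc a)" using noback[of a] a b by auto
  ultimately have b3: "Suc (Suc a) < b" using a by linarith
  obtain b' where b': "b = Suc b'" using a by (cases b) auto
  have two: "{y. E x y} = {u, v}" if "E x u" "E x v" "u \<noteq> v" for x u v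
    using card_seteq[OF fin, of "{u, v}" x] deg[of x] that by auto
  have "a = 0"
  proof (rule ccontr)
    assume "a \<noteq> 0"
    then obtain a' where a': "a = Suc a'" by (cases a) auto
    have "{y. E (w a) y} = {w a', w (Suc a)}"
      using two[of "w a" "w a'" "w (Suc a)"] step[of a'] step[of a] noback[of a'] sym a a' b by auto
    moreover have "E (w a) (w b')" using step[of b'] sym a b b' by auto
    ultimately have "w b' = w a' \<or> w b' = w (Suc a)" by blast
    then show False using distinct[of b' a'] distinct[of b' "Suc a"] b3 a a' b' by auto
  qed
  have "core E (w ` {..<b})"
    unfolding core_def
  proof (intro conjI ballI)
    fix x assume "x \<in> w ` {..<b}"
    then obtain k where k: "k < b" "x = w k" by auto
    have "\<exists>u v. u \<in> w ` {..<b} \<and> v \<in> w ` {..<b} \<and> u \<noteq> v \<and> E x u \<and> E x v"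
    proof -
      \<comment> \<open>\<open>k'\<close> and \<open>k''\<close> are successor and predecessor of
        \<open>k\<close> modulo \<open>b\<close>; the wrap-around is an edge because
        \<open>w b = w 0\<close>.\<close>
      define k' where "k' = (if Suc k = b then 0 else Suc k)"
      define k'' where "k'' = (if k = 0 then b' else k - 1)"
      have "k' < b" "k'' < b" "k' \<noteq> k''" using b3 k b' by (auto simp: k'_def k''_def)
      moreover have "E x (w k')"
        using step[of k] k b a \<open>a = 0\<close> by (auto simp: k'_def)
      moreover have "E x (w k'')"
        using step[of "k - 1"] step[of b'] sym k b b' a \<open>a = 0\<close> by (auto simp: k''_def)
      ultimately show ?thesis using distinct by blast
    qed
    then obtain u v where uv: "u \<in> w ` {..<b}" "v \<in> w ` {..<b}" "u \<noteq> v" "E x u" "E x v" by blast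
    then have "{y. E x y} = {u, v}" using two by blast
    then show "card {y. E x y} = 2" "{y. E x y} \<subseteq> w ` {..<b}" using uv by auto
  qed (use a in auto)
  moreover have "w 0 \<in> w ` {..<b}" "w ` {..<b} \<subseteq> w ` {..n}" using a b by auto
  ultimately show ?thesis by blast
qed

text \<open>At \<open>k = 0\<close> truncated subtraction makes \<open>p = c = i\<close>. For the
  irreflexive \<open>row_adj\<close> the condition to avoid \<open>p\<close> then excludes no first
  step, so the walk may leave \<open>i\<close> in either direction.\<close>

definition high_walk :: "(nat \<Rightarrow> nat \<Rightarrow> bool) \<Rightarrow> nat \<Rightarrow> nat \<Rightarrow> nat \<Rightarrow> nat \<Rightarrow> bool" where
  "high_walk E i k p c \<longleftrightarrow>
     (\<exists>w. walk E w k \<and> w 0 = i \<and> w (k - 1) = p \<and> w k = c \<and> (\<forall>m\<le>k. i \<le> w m))"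

lemma high_walk_0: "high_walk E i 0 i i"
  by (auto simp: high_walk_def walk_def intro: exI[of _ "\<lambda>_. i"])

lemma high_walk_Suc:
  assumes "high_walk E i k p c" "E c x" "x \<noteq> p" "i \<le> x"
  shows "high_walk E i (Suc k) c x"
proof -
  from assms(1) obtain w where w: "walk E w k" "w 0 = i" "w (k - 1) = p" "w k = c" "\<forall>m\<le>k. i \<le> w m"
    by (auto simp: high_walk_def)
  have "w m \<noteq> x" if "Suc m = k" for m
    using w(3) assms(3) that by auto
  then have "walk E (w(Suc k := x)) (Suc k)"
    using w assms by (auto simp: walk_def less_Suc_eq)
  then show ?thesis
    unfolding high_walk_def using w assms by (intro exI[of _ "w(Suc k := x)"]) (auto simp: le_Suc_eq)
qed

lemma high_walk_in_core:
  assumes "high_walk E i k p c" "core E S" "i \<in> S"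
  shows "c \<in> S"
  using assms walk_in_core[of E _ k S k] by (auto simp: high_walk_def)

text \<open>A walk from a core vertex cannot leave the core, and there every vertex has a neighbour
  besides \<open>p\<close>. A dead end therefore refutes \<open>i\<close>, whichever direction was
  chosen at the start.\<close>

lemma high_walk_stuck:
  assumes "high_walk E i k p c" "\<And>x. E c x \<Longrightarrow> x = p"
  shows "i \<notin> core_minima E"
proof
  assume "i \<in> core_minima E"
  then obtain S where "core E S" "i \<in> S" by (auto simp: core_minima_def)
  then have "card {y. E c y} = 2" using high_walk_in_core[OF assms(1)] by (auto simp: core_def)
  moreover have "card {y. E c y} \<le> card {p}" using assms(2) by (intro card_mono) auto
  ultimately show False by simp
qed

lemma high_walk_below:
  assumes "high_walk E i k p c" "E c x" "x < i"
  shows "i \<notin> core_minima E"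
proof
  assume "i \<in> core_minima E"
  then obtain S where S: "core E S" "i \<in> S" "\<forall>x\<in>S. i \<le> x" by (auto simp: core_minima_def)
  then have "x \<in> S" using high_walk_in_core[OF assms(1)] assms(2) by (auto simp: core_def)
  then show False using S assms(3) by auto
qed

text \<open>The core closed up by the walk consists of visited vertices only, and these are all at
  least \<open>i\<close>.\<close>

lemma high_walk_long:
  assumes "finite V" "\<And>x y. E x y \<Longrightarrow> E y x" "\<And>x. \<not> E x x"
    "\<And>x y. E x y \<Longrightarrow> x \<in> V" "\<And>x. card {y. E x y} \<le> 2"
    and "card V \<le> n" "0 < n" "high_walk E i n p c"
  shows "i \<in> core_minima E"
proof -
  from assms(8) obtain w where w: "walk E w n" "w 0 = i" "\<forall>m\<le>n. i \<le> w m"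
    by (auto simp: high_walk_def)
  have "\<exists>S. core E S \<and> w 0 \<in> S \<and> S \<subseteq> w ` {..n}"
    by (rule long_walk_core[OF assms(1-5) w(1) assms(6,7)])
  then obtain S where "core E S" "i \<in> S" "S \<subseteq> w ` {..n}"
    using w(2) by blast
  then show ?thesis using w(3) unfolding core_minima_def by blast
qed

section \<open>The row graph of a matrix\<close>

definition row_adj :: "nat mat \<Rightarrow> nat \<Rightarrow> nat \<Rightarrow> bool" where
  "row_adj M x y \<longleftrightarrow> x < dim_row M \<and> y < dim_row M \<and> x \<noteq> y \<and>
     (\<exists>j<dim_col M. M $$ (x, j) = 1 \<and> M $$ (y, j) = 1)"

lemma row_adj_sym: "row_adj M x y \<Longrightarrow> row_adj M y x"
  by (auto simp: row_adj_def)

lemma row_adj_irrefl: "\<not> row_adj M x x"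
  by (auto simp: row_adj_def)

lemma row_adj_dim: "row_adj M x y \<Longrightarrow> x \<in> {..<dim_row M}"
  by (auto simp: row_adj_def)

lemma finite_row_adj: "finite {y. row_adj M x y}"
  by (rule finite_subset[of _ "{..<dim_row M}"]) (auto simp: row_adj_def)

text \<open>Neighbours are reached through the at most two columns in which row \<open>x\<close> has
  a one, and each of these holds at most one further row.\<close>

lemma card_row_adj:
  assumes "xy_matrix 2 2 M"
  shows "card {y. row_adj M x y} \<le> 2"
proof (cases "x < dim_row M")
  case True
  let ?J = "{j. j < dim_col M \<and> M $$ (x, j) = 1}"
  let ?I = "\<lambda>j. {i. i < dim_row M \<and> M $$ (i, j) = 1}"
  have one: "card (?I j - {x}) \<le> 1" if "j \<in> ?J" for j
  proof -
    have "card (?I j) \<le> 2" "x \<in> ?I j" using assms that True by (auto simp: xy_matrix_def)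
    then show ?thesis by simp
  qed
  have "card {y. row_adj M x y} \<le> card (\<Union>j\<in>?J. ?I j - {x})"
    by (rule card_mono) (auto simp: row_adj_def)
  also have "\<dots> \<le> (\<Sum>j\<in>?J. card (?I j - {x}))"
    by (rule card_UN_le) simp
  also have "\<dots> \<le> (\<Sum>j\<in>?J. 1)"
    by (rule sum_mono) (rule one)
  also have "\<dots> \<le> 2" using assms True by (simp add: xy_matrix_def)
  finally show ?thesis .
next
  case False
  then show ?thesis by (simp add: row_adj_def)
qed

text \<open>Two ones of a column at places that are not adjacent would force a third one between
  them. The position of a row is its image under the inverse of the permutation
  \<open>\<pi>\<close>.\<close>

lemma C1P_cols_positions:
  assumes "C1P_cols A"
    and two: "\<And>j. j < dim_col A \<Longrightarrow> card {i. i < dim_row A \<and> A $$ (i, j) = 1} \<le> 2"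
  shows "\<exists>pos. inj_on pos {..<dim_row A} \<and>
    (\<forall>x y. row_adj A x y \<longrightarrow> pos y = Suc (pos x) \<or> pos x = Suc (pos y))"
proof -
  let ?n = "dim_row A"
  from assms(1) obtain \<pi> where \<pi>: "\<pi> permutes {..<?n}"
    and cons: "\<And>j. j < dim_col A \<Longrightarrow> consecutive_ones (col (permute_rows \<pi> A) j)"
    by (auto simp: C1P_cols_def)
  have inj: "inj \<pi>" using \<pi> permutes_inj by blast
  have lt: "\<pi> a < ?n \<longleftrightarrow> a < ?n" for a using permutes_in_image[OF \<pi>, of a] by simp
  have no_gap: "b = Suc a" if "a < b" "b < ?n" "j < dim_col A" "A $$ (\<pi> a, j) = 1" "A $$ (\<pi> b, j) = 1"
    for a b j
  proof (rule ccontr)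
    assume "b \<noteq> Suc a"
    with that have "a < Suc a" "Suc a < b" by auto
    then have "A $$ (\<pi> (Suc a), j) = 1"
      using cons[OF that(3), unfolded consecutive_ones_def, rule_format, of a "Suc a" b] that
      by (simp add: permute_rows_def)
    then have "{\<pi> a, \<pi> (Suc a), \<pi> b} \<subseteq> {i. i < ?n \<and> A $$ (i, j) = 1}"
      using that lt \<open>Suc a < b\<close> by auto
    then have "card {\<pi> a, \<pi> (Suc a), \<pi> b} \<le> card {i. i < ?n \<and> A $$ (i, j) = 1}"
      by (intro card_mono) auto
    with two[OF that(3)] have "card {\<pi> a, \<pi> (Suc a), \<pi> b} \<le> 2" by linarith
    moreover have "card {\<pi> a, \<pi> (Suc a), \<pi> b} = 3"
      using \<open>Suc a < b\<close> inj by (auto simp: inj_eq)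
    ultimately show False by simp
  qed
  show ?thesis
  proof (intro exI[of _ "inv_into UNIV \<pi>"] conjI allI impI)
    show "inj_on (inv_into UNIV \<pi>) {..<?n}"
      using permutes_inj[OF permutes_inv[OF \<pi>]] by (rule inj_on_subset) simp
    fix x y assume adj: "row_adj A x y"
    have "\<pi> (inv_into UNIV \<pi> x) = x" "\<pi> (inv_into UNIV \<pi> y) = y" using permutes_inverses[OF \<pi>] by auto
    moreover from this have "inv_into UNIV \<pi> x < ?n" "inv_into UNIV \<pi> y < ?n" "inv_into UNIV \<pi> x \<noteq> inv_into UNIV \<pi> y"
      using adj lt by (metis row_adj_def)+
    ultimately show "inv_into UNIV \<pi> y = Suc (inv_into UNIV \<pi> x) \<or> inv_into UNIV \<pi> x = Suc (inv_into UNIV \<pi> y)"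
      using adj no_gap unfolding row_adj_def by (metis linorder_neqE_nat)
  qed
qed

lemma nth_list_permutes:
  assumes "distinct xs" "set xs = {..<n}"
  shows "(\<lambda>i. if i < n then xs ! i else i) permutes {..<n}"
proof -
  have len: "length xs = n" using assms distinct_card by fastforce
  have "bij_betw ((!) xs) {..<n} {..<n}"
    using len assms by (intro bij_betw_nth) auto
  then have "bij_betw (\<lambda>i. if i < n then xs ! i else i) {..<n} {..<n}"
    by (subst bij_betw_cong[where g = "(!) xs"]) auto
  then show ?thesis by (rule bij_imp_permutes) simp
qed

text \<open>
  In an arrangement of the rows in which every column occupies one place or two adjacent places,
  sorting the columns by the sum of their first and last place makes the rows consecutive: the row
  at place \<open>k\<close> meets exactly the columns with first plus last place in \<open>{2 * k - 1..2 * k + 1}\<close>.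
  The shift by 2 below keeps the empty columns, which get the key 0, out of this range.
\<close>

lemma SC1P_arrangement:
  assumes xs: "distinct xs" "set xs = {..<dim_row A}"
    and adj: "\<And>x y. row_adj A x y \<Longrightarrow> consec xs x y \<or> consec xs y x"
  shows "SC1P A"
proof -
  let ?n = "dim_row A" and ?m = "dim_col A"
  have len: "length xs = ?n" using xs distinct_card by fastforce
  have lt: "xs ! a < ?n" if "a < ?n" for a using that len xs(2) nth_mem by force
  have no_gap: "b = Suc a" if "a < b" "b < ?n" "j < ?m" "A $$ (xs ! a, j) = 1" "A $$ (xs ! b, j) = 1"
    for a b j
  proof -
    have "xs ! a \<noteq> xs ! b" using that len xs(1) by (simp add: nth_eq_iff_index_eq)
    then have "row_adj A (xs ! a) (xs ! b)" using that lt by (auto simp: row_adj_def)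
    from adj[OF this] consec_nth obtain i where "Suc i < length xs"
      "xs ! i = xs ! a \<and> xs ! Suc i = xs ! b \<or> xs ! i = xs ! b \<and> xs ! Suc i = xs ! a"
      by metis
    then show ?thesis using that len xs(1) by (auto simp: nth_eq_iff_index_eq)
  qed
  have "A $$ (xs ! b, j) = 1"
    if "j < ?m" "a < b" "b < c" "c < ?n" "A $$ (xs ! a, j) = 1" "A $$ (xs ! c, j) = 1" for j a b c
    using no_gap[of a c j] that by linarith
  then have "C1P_cols A"
    unfolding C1P_cols_def
    by (intro exI[of _ "\<lambda>i. if i < ?n then xs ! i else i"] conjI nth_list_permutes[OF xs])
       (auto simp: consecutive_ones_def permute_rows_def col_def)
  moreover have "C1P_rows A"
  proof -
    define P where "P j = {a. a < ?n \<and> A $$ (xs ! a, j) = 1}" for j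
    define key where "key j = (if P j = {} then 0 else Min (P j) + Max (P j) + 2)" for j
    have key: "k \<in> P j \<longleftrightarrow> 2 * k + 1 \<le> key j \<and> key j \<le> 2 * k + 3" if "j < ?m" for j k
    proof (cases "P j = {}")
      case False
      have fin: "finite (P j)" by (simp add: P_def)
      define a where "a = Min (P j)"
      have a: "a \<in> P j" "\<And>b. b \<in> P j \<Longrightarrow> a \<le> b" using fin False by (auto simp: a_def)
      have "b = a \<or> b = Suc a" if "b \<in> P j" for b
        using no_gap[of a b j] a(1) a(2)[OF that] that \<open>j < ?m\<close> by (auto simp: P_def le_less)
      then consider "P j = {a}" | "P j = {a, Suc a}" using a(1) by blast
      then show ?thesis
      proof cases
        case 1
        then have "key j = 2 * a + 2" by (simp add: key_def)
        with 1 show ?thesis by (simp, linarith)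
      next
        case 2
        then have "key j = 2 * a + 3" by (simp add: key_def)
        with 2 show ?thesis by (simp, linarith)
      qed
    qed (simp add: key_def)
    define ys where "ys = sort_key key [0..<?m]"
    have ys: "distinct ys" "set ys = {..<?m}" "length ys = ?m" "sorted (map key ys)"
      by (simp_all only: ys_def distinct_sort distinct_upt set_sort set_upt atLeast0LessThan
          length_sort length_upt sorted_sort_key minus_nat.diff_0)
    have ylt: "ys ! a < ?m" if "a < ?m" for a using that ys nth_mem by force
    have mono: "key (ys ! a) \<le> key (ys ! b)" if "a < b" "b < ?m" for a b
      using sorted_nth_mono[OF ys(4), of a b] that ys(3) by simp
    have "A $$ (i, ys ! b) = 1"
      if "i < ?n" "a < b" "b < c" "c < ?m" "A $$ (i, ys ! a) = 1" "A $$ (i, ys ! c) = 1" for i a b c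
    proof -
      have "i \<in> set xs" using that(1) by (simp add: xs(2))
      then obtain k where k: "k < ?n" "xs ! k = i" unfolding in_set_conv_nth len by blast
      have in_P: "k \<in> P j \<longleftrightarrow> A $$ (i, j) = 1" for j
        unfolding P_def mem_Collect_eq k(2) using k(1) by blast
      have "k \<in> P (ys ! a)" "k \<in> P (ys ! c)" using that by (simp_all only: in_P)
      then have "2 * k + 1 \<le> key (ys ! a)" "key (ys ! c) \<le> 2 * k + 3"
        using key ylt that by (meson less_trans)+
      then have "2 * k + 1 \<le> key (ys ! b)" "key (ys ! b) \<le> 2 * k + 3"
        using mono[of a b] mono[of b c] that by linarith+
      then have "k \<in> P (ys ! b)" using key ylt that by (meson less_trans)
      then show ?thesis by (simp only: in_P)
    qed
    then show ?thesis
      unfolding C1P_rows_def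
      by (intro exI[of _ "\<lambda>i. if i < ?m then ys ! i else i"] conjI nth_list_permutes[OF ys(1,2)])
         (auto simp: consecutive_ones_def permute_cols_def row_def)
  qed
  ultimately show ?thesis by (simp add: SC1P_def)
qed

text \<open>\<open>submatrix\<close> numbers the remaining rows by \<open>pick (- R)\<close>. Since
  \<open>- R\<close> is infinite, \<open>pick\<close> enumerates all of it, and its first values are
  the kept rows below \<open>n\<close>.\<close>

lemma bij_betw_pick:
  assumes "finite R"
  shows "bij_betw (pick (- R)) {..<card {i. i < n \<and> i \<in> - R}} {i. i < n \<and> i \<notin> R}"
proof -
  have inf: "infinite (- R)" using assms by (simp add: Compl_eq_Diff_UNIV)
  let ?p = "pick (- R)" and ?m = "card {i. i < n \<and> i \<in> - R}"
  have inj: "inj_on ?p {..<?m}" using pick_eq_iff_inf[OF inf] by (auto simp: inj_on_def)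
  moreover have sub: "?p ` {..<?m} \<subseteq> {i. i < n \<and> i \<notin> R}"
    using pick_in_set_inf[OF inf] pick_le[of _ n "- R"] by auto
  moreover have "card (?p ` {..<?m}) = card {i. i < n \<and> i \<notin> R}"
    using inj by (simp add: card_image)
  ultimately show ?thesis
    by (simp add: bij_betw_def card_subset_eq)
qed

text \<open>Up to the renumbering \<open>pick (- R)\<close>, the row graph of the smaller matrix is
  the induced graph \<open>?E\<close>, whose cores are the cores of the full graph that avoid
  \<open>R\<close>. An order of the rows excludes cores by positions, and absence of cores yields a
  linear arrangement.\<close>

lemma SC1P_delete_rows_iff:
  assumes M: "xy_matrix 2 2 M" and R: "R \<subseteq> {..<dim_row M}"
  shows "SC1P (delete_rows R M) \<longleftrightarrow> (\<forall>S. core (row_adj M) S \<longrightarrow> S \<inter> R \<noteq> {})"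
proof -
  let ?A = "delete_rows R M" and ?p = "pick (- R)"
  let ?E = "\<lambda>x y. row_adj M x y \<and> x \<notin> R \<and> y \<notin> R"
  have finR: "finite R" using R finite_subset by blast
  have dims: "dim_row ?A = card {i. i < dim_row M \<and> i \<in> - R}" "dim_col ?A = dim_col M"
    by (auto simp: delete_rows_def dim_submatrix)
  have bij: "bij_betw ?p {..<dim_row ?A} {i. i < dim_row M \<and> i \<notin> R}"
    unfolding dims by (rule bij_betw_pick[OF finR])
  have entry: "?A $$ (i, j) = M $$ (?p i, j)" if "i < dim_row ?A" "j < dim_col M" for i j
    using that dims by (auto simp: delete_rows_def submatrix_index pick_UNIV)
  have p: "?p i < dim_row M" "?p i \<notin> R" if "i < dim_row ?A" for i
    using bij that by (auto simp: bij_betw_def)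
  have pinj: "?p a = ?p b \<longleftrightarrow> a = b" if "a < dim_row ?A" "b < dim_row ?A" for a b
    using bij that by (auto simp: bij_betw_def inj_on_def)
  have adj: "row_adj ?A a b \<longleftrightarrow> ?E (?p a) (?p b)" if "a < dim_row ?A" "b < dim_row ?A" for a b
    using that p pinj[OF that] by (auto simp: row_adj_def dims(2) entry)
  have nbrs: "{y. ?E (?p a) y} = ?p ` {b. row_adj ?A a b}" if "a < dim_row ?A" for a
  proof
    show "?p ` {b. row_adj ?A a b} \<subseteq> {y. ?E (?p a) y}"
      using adj[OF that] row_adj_sym row_adj_dim by blast
    show "{y. ?E (?p a) y} \<subseteq> ?p ` {b. row_adj ?A a b}"
    proof
      fix y assume y: "y \<in> {y. ?E (?p a) y}"
      then have "y \<in> ?p ` {..<dim_row ?A}" using bij by (auto simp: bij_betw_def row_adj_def)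
      then show "y \<in> ?p ` {b. row_adj ?A a b}" using y adj[OF that] by auto
    qed
  qed
  have card: "card {b. row_adj ?A a b} = card {y. ?E (?p a) y}" if "a < dim_row ?A" for a
    unfolding nbrs[OF that]
    by (rule card_image[symmetric], rule inj_on_subset[of _ "{..<dim_row ?A}"])
       (use bij in \<open>auto simp: bij_betw_def row_adj_def\<close>)
  have induced: "core ?E S \<longleftrightarrow> core (row_adj M) S \<and> S \<inter> R = {}" for S
    by (rule core_induced[OF card_row_adj[OF M] finite_row_adj])
  show ?thesis
  proof
    assume "SC1P ?A"
    moreover have "card {i. i < dim_row ?A \<and> ?A $$ (i, j) = 1} \<le> 2" if j: "j < dim_col ?A" for j
    proof -
      have "card {i. i < dim_row ?A \<and> ?A $$ (i, j) = 1} \<le> card {i. i < dim_row M \<and> M $$ (i, j) = 1}"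
        by (rule card_inj_on_le[of ?p]) (use j p pinj in \<open>auto simp: inj_on_def entry dims(2)\<close>)
      then show ?thesis using M j by (auto simp: xy_matrix_def dims(2))
    qed
    ultimately obtain pos where pos: "inj_on pos {..<dim_row ?A}"
      "\<And>x y. row_adj ?A x y \<Longrightarrow> pos y = Suc (pos x) \<or> pos x = Suc (pos y)"
      using C1P_cols_positions[of ?A] by (auto simp: SC1P_def)
    \<comment> \<open>\<open>q\<close> turns a kept row of \<open>M\<close> into its row number in
      the smaller matrix, so that positions found there can be used on \<open>?E\<close>.\<close>
    define q where "q = inv_into {..<dim_row ?A} ?p"
    have q: "q x < dim_row ?A" "?p (q x) = x" if "x < dim_row M" "x \<notin> R" for x
      using that bij unfolding q_def
      by (metis (mono_tags, lifting) bij_betw_def inv_into_into lessThan_iff mem_Collect_eq,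
          metis (mono_tags, lifting) bij_betw_inv_into_right mem_Collect_eq)
    show "\<forall>S. core (row_adj M) S \<longrightarrow> S \<inter> R \<noteq> {}"
    proof (intro allI impI notI)
      fix S assume "core (row_adj M) S" "S \<inter> R = {}"
      then have core: "core ?E S" using induced by blast
      have S: "x < dim_row M" "x \<notin> R" if "x \<in> S" for x
      proof -
        from core that obtain y where "?E x y" by (rule core_neighbour)
        then show "x < dim_row M" "x \<notin> R" by (auto simp: row_adj_def)
      qed
      have "\<not> core ?E S"
      proof (rule no_core_of_positions[of "pos \<circ> q"])
        have "inj_on q S" using q(2) S by (metis inj_onI)
        moreover have "inj_on pos (q ` S)" using q S by (intro inj_on_subset[OF pos(1)]) auto
        ultimately show "inj_on (pos \<circ> q) S" by (rule comp_inj_on)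
        fix x y assume "x \<in> S" and e: "?E x y"
        then have x: "x < dim_row M" "x \<notin> R" and y: "y < dim_row M" "y \<notin> R"
          by (auto simp: row_adj_def)
        have "row_adj ?A (q x) (q y)" using adj[of "q x" "q y"] q[OF x] q[OF y] e by simp
        from pos(2)[OF this]
        show "(pos \<circ> q) y = Suc ((pos \<circ> q) x) \<or> (pos \<circ> q) x = Suc ((pos \<circ> q) y)" by simp
      qed
      with core show False by blast
    qed
  next
    assume nocore: "\<forall>S. core (row_adj M) S \<longrightarrow> S \<inter> R \<noteq> {}"
    have "\<exists>xs. distinct xs \<and> set xs = {..<dim_row ?A} \<and>
      (\<forall>x y. row_adj ?A x y \<longrightarrow> consec xs x y \<or> consec xs y x)"
    proof (rule linear_arrangement)
      show "card {b. row_adj ?A a b} \<le> 2" for a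
      proof (cases "a < dim_row ?A")
        case True
        have "card {y. ?E (?p a) y} \<le> card {y. row_adj M (?p a) y}"
          by (rule card_mono[OF finite_row_adj]) auto
        with card[OF True] card_row_adj[OF M, of "?p a"] show ?thesis by linarith
      next
        case False
        then have "{b. row_adj ?A a b} = {}" by (auto simp: row_adj_def)
        then show ?thesis by (metis card.empty zero_le)
      qed
      show "\<not> core (row_adj ?A) S" for S
      proof
        assume core: "core (row_adj ?A) S"
        have S: "a < dim_row ?A" if "a \<in> S" for a
        proof -
          from core that obtain b where "row_adj ?A a b" by (rule core_neighbour)
          then show ?thesis by (auto simp: row_adj_def)
        qed
        have "core ?E (?p ` S)"
          unfolding core_def
        proof (intro conjI ballI)
          fix x assume "x \<in> ?p ` S"
          then obtain a where a: "a \<in> S" "x = ?p a" by auto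
          show "card {y. ?E x y} = 2"
            using core a card[OF S[OF a(1)]] by (auto simp: core_def)
          show "{y. ?E x y} \<subseteq> ?p ` S"
            using core a nbrs[OF S[OF a(1)]] by (auto simp: core_def)
        qed (use core in \<open>auto simp: core_def\<close>)
        then show False using nocore induced by blast
      qed
    qed (auto simp: row_adj_def)
    then show "SC1P ?A" using SC1P_arrangement by blast
  qed
qed

text \<open>An admissible \<open>R\<close> meets every core and so is at least as large as the set
  of core minima; conversely this set meets every core and can be deleted itself.\<close>

theorem SC1S_R_iff_card_core_minima:
  assumes "xy_matrix 2 2 M"
  shows "SC1S_R d M \<longleftrightarrow> card (core_minima (row_adj M)) \<le> d"
proof
  assume "SC1S_R d M"
  then obtain R where R: "R \<subseteq> {..<dim_row M}" "card R \<le> d" "SC1P (delete_rows R M)"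
    by (auto simp: SC1S_R_def)
  then have "\<And>S. core (row_adj M) S \<Longrightarrow> S \<inter> R \<noteq> {}"
    using SC1P_delete_rows_iff[OF assms R(1)] by blast
  then have "card (core_minima (row_adj M)) \<le> card R"
    using card_core_minima_le[of "row_adj M" R] row_adj_sym R(1) finite_subset by blast
  with R show "card (core_minima (row_adj M)) \<le> d" by simp
next
  assume le: "card (core_minima (row_adj M)) \<le> d"
  have sub: "core_minima (row_adj M) \<subseteq> {..<dim_row M}"
    by (rule core_minima_subset) (rule row_adj_dim)
  show "SC1S_R d M"
    unfolding SC1S_R_def using le sub SC1P_delete_rows_iff[OF assms sub] core_meets_core_minima by blast
qed

section \<open>While programs on read-only tapes\<close>

datatype com =
    Skip
  | Halt bool
  | Move nat direction
  | Seq com com  (infixr ";;" 60)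
  | If nat "nat set" com com
  | While nat "nat set" com

text \<open>A step yields the next program and one head move. The pair \<open>0, Stay\<close> means
  that no head moves, and \<open>Skip\<close> and \<open>Halt\<close> step to themselves.\<close>

fun com_step :: "com \<Rightarrow> (nat \<Rightarrow> nat) \<Rightarrow> com \<times> nat \<times> direction" where
  "com_step Skip v = (Skip, 0, Stay)"
| "com_step (Halt b) v = (Halt b, 0, Stay)"
| "com_step (Move t d) v = (Skip, t, d)"
| "com_step (a ;; b) v =
     (if a = Skip then (b, 0, Stay) else (case com_step a v of (a', m) \<Rightarrow> (a' ;; b, m)))"
| "com_step (If t S a b) v = (if v t \<in> S then a else b, 0, Stay)"
| "com_step (While t S a) v = (if v t \<in> S then a ;; While t S a else Skip, 0, Stay)"

text \<open>A finite set containing the program and closed under \<open>com_step\<close>: these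
  programs become the states of the machine.\<close>

fun residuals :: "com \<Rightarrow> com set" where
  "residuals Skip = {Skip}"
| "residuals (Halt b) = {Halt b}"
| "residuals (Move t d) = {Move t d, Skip}"
| "residuals (a ;; b) = (\<lambda>x. x ;; b) ` residuals a \<union> residuals b"
| "residuals (If t S a b) = {If t S a b} \<union> residuals a \<union> residuals b"
| "residuals (While t S a) = {While t S a, Skip} \<union> (\<lambda>x. x ;; While t S a) ` residuals a"

fun tapes :: "com \<Rightarrow> nat set" where
  "tapes Skip = {}"
| "tapes (Halt b) = {}"
| "tapes (Move t d) = {t}"
| "tapes (a ;; b) = tapes a \<union> tapes b"
| "tapes (If t S a b) = {t} \<union> tapes a \<union> tapes b"
| "tapes (While t S a) = {t} \<union> tapes a"

text \<open>In contrast to \<open>tapes\<close>, tapes that are only tested do not count. Thus a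
  loop counter can be seen syntactically to be left alone by the loop body.\<close>

fun moved :: "com \<Rightarrow> nat set" where
  "moved Skip = {}"
| "moved (Halt b) = {}"
| "moved (Move t d) = {t}"
| "moved (a ;; b) = moved a \<union> moved b"
| "moved (If t S a b) = moved a \<union> moved b"
| "moved (While t S a) = moved a"

lemma finite_residuals: "finite (residuals c)"
  by (induction c) auto

lemma residuals_refl: "c \<in> residuals c"
  by (induction c) auto

lemma com_step_residuals: "x \<in> residuals c \<Longrightarrow> fst (com_step x v) \<in> residuals c"
proof (induction c arbitrary: x)
  case (Seq a b)
  have "fst (com_step (y ;; b) v) \<in> residuals (a ;; b)" if "y \<in> residuals a" for y
    using Seq.IH(1)[OF that] residuals_refl[of b] by (cases "com_step y v") auto
  with Seq(2-) show ?case by (auto simp del: com_step.simps)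
next
  case (If t S a b)
  then show ?case using residuals_refl[of a] residuals_refl[of b] by auto
next
  case (While t S a)
  have "fst (com_step (y ;; While t S a) v) \<in> residuals (While t S a)" if "y \<in> residuals a" for y
    using While.IH[OF that] by (cases "com_step y v") auto
  then show ?case using While.prems residuals_refl[of a] by (auto simp del: com_step.simps(4))
qed auto

lemma tapes_residuals: "x \<in> residuals c \<Longrightarrow> tapes x \<subseteq> tapes c"
proof (induction c arbitrary: x)
  case (Seq a b)
  then show ?case by fastforce
next
  case (While t S a)
  then show ?case by fastforce
qed auto

text \<open>The machine sees a list of \<open>k\<close> symbols, the program semantics a function on
  all tape numbers; on the tapes that occur, both give the same step.\<close>

lemma com_step_cong:
  "tapes c \<subseteq> T \<Longrightarrow> (\<And>t. t \<in> T \<Longrightarrow> v t = v' t) \<Longrightarrow> com_step c v = com_step c v'"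
  by (induction c) (auto split: prod.splits)

definition tape_content :: "bool list \<Rightarrow> nat \<Rightarrow> nat \<Rightarrow> nat" where
  "tape_content w t = (if t = 0 then fst (input_tape w) else fst blank_tape)"

locale tape_run =
  fixes w :: "bool list" and B :: nat
begin

abbreviation sym :: "(nat \<Rightarrow> nat) \<Rightarrow> nat \<Rightarrow> nat" where
  "sym s t \<equiv> tape_content w t (s t)"

text \<open>
  Big-step semantics on head positions. A move beyond cell \<open>B\<close> has no derivation, so that every
  derivation bounds the space used on the way.
\<close>

inductive big :: "com \<Rightarrow> (nat \<Rightarrow> nat) \<Rightarrow> (nat \<Rightarrow> nat) \<Rightarrow> bool" where
  big_Skip: "big Skip s s"
| big_Move: "move_head d (s t) \<le> B \<Longrightarrow> big (Move t d) s (s(t := move_head d (s t)))"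
| big_Seq: "big a s s' \<Longrightarrow> big b s' s'' \<Longrightarrow> big (a ;; b) s s''"
| big_IfT: "sym s t \<in> S \<Longrightarrow> big a s s' \<Longrightarrow> big (If t S a b) s s'"
| big_IfF: "sym s t \<notin> S \<Longrightarrow> big b s s' \<Longrightarrow> big (If t S a b) s s'"
| big_WhileF: "sym s t \<notin> S \<Longrightarrow> big (While t S a) s s"
| big_WhileT: "sym s t \<in> S \<Longrightarrow> big a s s' \<Longrightarrow> big (While t S a) s' s'' \<Longrightarrow> big (While t S a) s s''"

lemma big_unmoved: "big c s s' \<Longrightarrow> v \<notin> moved c \<Longrightarrow> s' v = s v"
  by (induction rule: big.induct) auto

definition bounded :: "(nat \<Rightarrow> nat) \<Rightarrow> bool" where
  "bounded s \<longleftrightarrow> (\<forall>t. s t \<le> B)"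

definition conf_step :: "com \<times> (nat \<Rightarrow> nat) \<Rightarrow> com \<times> (nat \<Rightarrow> nat)" where
  "conf_step = (\<lambda>(c, s). case com_step c (sym s) of (c', t, d) \<Rightarrow> (c', s(t := move_head d (s t))))"

text \<open>Requiring the bound at both ends confines a run to the bounded configurations, which are
  finitely many as far as the machine's own tapes are concerned.\<close>

inductive small :: "com \<times> (nat \<Rightarrow> nat) \<Rightarrow> com \<times> (nat \<Rightarrow> nat) \<Rightarrow> bool" where
  "bounded s \<Longrightarrow> conf_step (c, s) = (c', s') \<Longrightarrow> bounded s' \<Longrightarrow> small (c, s) (c', s')"

lemma small_Seq:
  assumes "small\<^sup>*\<^sup>* (a, s) (a', s')"
  shows "small\<^sup>*\<^sup>* (a ;; b, s) (a' ;; b, s')"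
  using assms
proof (induction a' s' rule: rtranclp_induct2)
  case refl
  then show ?case by simp
next
  case (step a1 s1 a2 s2)
  show ?case
  proof (cases "a1 = Skip")
    \<comment> \<open>\<open>Skip\<close> steps to itself, and this idle step has no counterpart in
      the run of the sequence.\<close>
    case True
    with step show ?thesis by (auto elim!: small.cases simp: conf_step_def)
  next
    case False
    with step(2) have "small (a1 ;; b, s1) (a2 ;; b, s2)"
      by (auto elim!: small.cases intro!: small.intros simp: conf_step_def split: prod.splits)
    with step(3) show ?thesis by simp
  qed
qed

lemma small_stay:
  assumes "bounded s" "com_step c (sym s) = (c', 0, Stay)"
  shows "small (c, s) (c', s)"
  using assms by (auto intro!: small.intros simp: conf_step_def)

lemma big_small: "big c s s' \<Longrightarrow> bounded s \<Longrightarrow> small\<^sup>*\<^sup>* (c, s) (Skip, s') \<and> bounded s'"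
proof (induction rule: big.induct)
  case (big_Move d s t)
  then have "small (Move t d, s) (Skip, s(t := move_head d (s t)))"
    by (intro small.intros) (auto simp: conf_step_def bounded_def)
  moreover from big_Move have "bounded (s(t := move_head d (s t)))"
    by (simp add: bounded_def)
  ultimately show ?case by blast
next
  case (big_Seq a s s' b s'')
  then have "small\<^sup>*\<^sup>* (a ;; b, s) (Skip ;; b, s')" and "small (Skip ;; b, s') (b, s')"
    and "small\<^sup>*\<^sup>* (b, s') (Skip, s'')" and "bounded s''"
    by (auto intro: small_Seq small_stay)
  then show ?case by (meson converse_rtranclp_into_rtranclp rtranclp_trans)
next
  case (big_IfT s t S a s' b)
  then have "small (If t S a b, s) (a, s)" by (auto intro: small_stay)
  with big_IfT show ?case by (meson converse_rtranclp_into_rtranclp)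
next
  case (big_IfF s t S b s' a)
  then have "small (If t S a b, s) (b, s)" by (auto intro: small_stay)
  with big_IfF show ?case by (meson converse_rtranclp_into_rtranclp)
next
  case (big_WhileF s t S a)
  then have "small (While t S a, s) (Skip, s)" by (auto intro: small_stay)
  with big_WhileF show ?case by (meson r_into_rtranclp)
next
  case (big_WhileT s t S a s' s'')
  then have "small (While t S a, s) (a ;; While t S a, s)"
    and "small\<^sup>*\<^sup>* (a ;; While t S a, s) (Skip ;; While t S a, s')"
    and "small (Skip ;; While t S a, s') (While t S a, s')"
    and "small\<^sup>*\<^sup>* (While t S a, s') (Skip, s'')" and "bounded s''"
    by (auto intro: small_Seq small_stay)
  then show ?case by (meson converse_rtranclp_into_rtranclp rtranclp_trans)
qed auto

end

section \<open>The Turing machine of a program\<close>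

text \<open>\<open>f\<close> numbers the residual programs \<open>D\<close>. Every transition writes
  back the symbol just read, so tape contents never change.\<close>

definition com_tm :: "nat \<Rightarrow> (com \<Rightarrow> nat) \<Rightarrow> com set \<Rightarrow> com \<Rightarrow> tm" where
  "com_tm k f D c = \<lparr>num_tapes = k, num_symbols = 4, num_states = card D, start_state = f c,
     accept_state = f (Halt True), reject_state = f (Halt False),
     delta = (\<lambda>q syms. case com_step (inv_into D f q) ((!) syms) of (c', t, d) \<Rightarrow>
       (f c', map (\<lambda>i. (syms ! i, if i = t then d else Stay)) [0..<k]))\<rparr>"

locale com_machine =
  fixes k :: nat and f :: "com \<Rightarrow> nat" and D :: "com set" and c :: com
  assumes k: "0 < k" and tapes: "tapes c \<subseteq> {..<k}"
    and D: "D = residuals c" and halt: "Halt True \<in> D" "Halt False \<in> D"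
    and f: "bij_betw f D {..<card D}"
begin

abbreviation "T \<equiv> com_tm k f D c"

lemma f_less: "x \<in> D \<Longrightarrow> f x < card D"
  using f by (auto simp: bij_betw_def)

lemma f_inj: "x \<in> D \<Longrightarrow> y \<in> D \<Longrightarrow> f x = f y \<longleftrightarrow> x = y"
  using f by (auto simp: bij_betw_def inj_on_def)

lemma inv_f: "x \<in> D \<Longrightarrow> inv_into D f (f x) = x"
  using f by (auto simp: bij_betw_def)

lemma inv_f_in: "q < card D \<Longrightarrow> inv_into D f q \<in> D"
  using f by (metis bij_betw_def inv_into_into lessThan_iff)

lemma step_in_D: "x \<in> D \<Longrightarrow> fst (com_step x v) \<in> D"
  by (simp add: D com_step_residuals)

lemma wf_T: "wf_tm T"
proof -
  have "c \<in> D" by (simp add: D residuals_refl)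
  moreover have "f (fst (com_step (inv_into D f q) v)) < card D" if "q < card D" for q v
    using that by (simp add: f_less inv_f_in step_in_D)
  moreover have "syms ! i < 4" if "length syms = k" "set syms \<subseteq> {..<4}" "i < k"
    for syms :: "nat list" and i
    using that by (metis lessThan_iff nth_mem subsetD)
  ultimately show ?thesis
    using k halt f_inj[OF halt]
    by (auto simp: wf_tm_def com_tm_def f_less split: prod.splits) (metis fst_conv)+
qed

definition conf :: "bool list \<Rightarrow> com \<Rightarrow> (nat \<Rightarrow> nat) \<Rightarrow> config" where
  "conf w x s = (f x, map (\<lambda>t. (tape_content w t, s t)) [0..<k])"

lemma init_conf: "init_config T w = conf w c (\<lambda>_. 0)"
proof -
  have "[0..<k] = 0 # map Suc [0..<k - 1]"
    using k by (metis Suc_pred' map_Suc_upt upt_conv_Cons)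
  then show ?thesis
    by (auto simp: init_config_def conf_def com_tm_def tape_content_def blank_tape_def
        input_tape_def o_def map_replicate_const)
qed

lemma tm_step_conf:
  assumes "x \<in> D" "x \<noteq> Halt True" "x \<noteq> Halt False"
    and step: "tape_run.conf_step w (x, s) = (x', s')"
  shows "tm_step T (conf w x s) = conf w x' s'"
proof -
  let ?tps = "map (\<lambda>t. (tape_content w t, s t)) [0..<k]"
  have "tapes x \<subseteq> {..<k}"
    using assms(1) tapes tapes_residuals D by blast
  then have eq: "com_step x ((!) (map read_tape ?tps)) = com_step x (\<lambda>t. tape_content w t (s t))"
    by (rule com_step_cong) auto
  obtain t d where st: "com_step x (\<lambda>t. tape_content w t (s t)) = (x', t, d)"
    and s': "s' = s(t := move_head d (s t))"
    using step by (auto simp: tape_run.conf_step_def split: prod.splits)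
  have "map2 act_tape (map (\<lambda>i. (map read_tape ?tps ! i, if i = t then d else Stay)) [0..<k]) ?tps
    = map (\<lambda>i. (tape_content w i, s' i)) [0..<k]"
    by (rule nth_equalityI) (auto simp: s')
  then show ?thesis
    using assms(1-3) halt
    by (simp add: tm_step_def conf_def com_tm_def f_inj inv_f eq[simplified] st)
qed

text \<open>The relation \<open>R\<close> of single steps from bounded configurations is finite, so
  any path in it can be replaced by one of length at most \<open>card R\<close>. Since
  \<open>R\<close> is part of a function, the short path is again the run of the machine. The bound
  counts states times the \<open>Suc B\<close> head positions on each of \<open>k\<close>
  tapes.\<close>

lemma accepts_rejects:
  assumes run: "(tape_run.small w B)\<^sup>*\<^sup>* (c, \<lambda>_. 0) (Halt b, s)"
    and t: "card D * Suc B ^ k \<le> t"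
  shows "if b then accepts_within T w t else rejects_within T w t"
proof -
  define A where "A = (\<lambda>(x, xs). conf w x (\<lambda>t. xs ! t)) ` (D \<times> {xs. set xs \<subseteq> {..B} \<and> length xs = k})"
  define R where "R = (\<lambda>a. (a, tm_step T a)) ` A"
  have finD: "finite D" by (simp add: D finite_residuals)
  then have finA: "finite A"
    unfolding A_def by (intro finite_imageI finite_cartesian_product finite_lists_length_eq) auto
  have "card A \<le> card (D \<times> {xs. set xs \<subseteq> {..B} \<and> length xs = k})"
    unfolding A_def using finD by (intro card_image_le finite_cartesian_product finite_lists_length_eq) auto
  also have "\<dots> = card D * Suc B ^ k"
    by (simp add: card_cartesian_product card_lists_length_eq)
  finally have cardA: "card A \<le> card D * Suc B ^ k" .
  have finR: "finite R" and cardR: "card R \<le> card A"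
    using finA by (auto simp: R_def card_image_le)
  have in_A: "conf w x s \<in> A" if "x \<in> D" "tape_run.bounded B s" for x s
  proof -
    have "conf w x s = conf w x (\<lambda>t. map s [0..<k] ! t)"
      by (auto simp: conf_def)
    moreover have "set (map s [0..<k]) \<subseteq> {..B} \<and> length (map s [0..<k]) = k"
      using that by (auto simp: tape_run.bounded_def)
    ultimately show ?thesis
      using that(1) unfolding A_def by (intro image_eqI[where x = "(x, map s [0..<k])"]) auto
  qed
  have "x \<in> D \<and> (conf w c (\<lambda>_. 0), conf w x s) \<in> R\<^sup>*"
    if "(tape_run.small w B)\<^sup>*\<^sup>* (c, \<lambda>_. 0) (x, s)" for x s
    using that
  proof (induction x s rule: rtranclp_induct2)
    case refl
    then show ?case by (simp add: D residuals_refl)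
  next
    case (step x s x' s')
    from step(2) have bd: "tape_run.bounded B s" and st: "tape_run.conf_step w (x, s) = (x', s')"
      by (auto elim: tape_run.small.cases)
    have x': "x' \<in> D"
      using st step(3) step_in_D[of x "\<lambda>t. tape_content w t (s t)"]
      by (auto simp: tape_run.conf_step_def split: prod.splits)
    show ?case
    proof (cases "x = Halt True \<or> x = Halt False")
      case True
      then have "x' = x" "s' = s" using st by (auto simp: tape_run.conf_step_def)
      with step show ?thesis by simp
    next
      case False
      then have "tm_step T (conf w x s) = conf w x' s'"
        using tm_step_conf st step(3) by blast
      then have "(conf w x s, conf w x' s') \<in> R"
        using in_A[of x s] bd step(3) by (auto simp: R_def)
      with step(3) x' show ?thesis by (meson rtrancl_into_rtrancl)
    qed
  qed
  from this[OF run] have "(conf w c (\<lambda>_. 0), conf w (Halt b) s) \<in> R\<^sup>*" by simp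
  then obtain n where n: "n \<le> card R" and path: "(conf w c (\<lambda>_. 0), conf w (Halt b) s) \<in> R ^^ n"
    using rtrancl_finite_eq_relpow[OF finR] by blast
  have "(tm_step T ^^ m) a = a'" if "(a, a') \<in> R ^^ m" for m a a'
    using that by (induction m arbitrary: a') (auto simp: R_def)
  from this[OF path] have "fst ((tm_step T ^^ n) (init_config T w)) = f (Halt b)"
    by (simp add: init_conf) (simp add: conf_def)
  moreover have "n \<le> t" using n cardR cardA t by linarith
  ultimately show ?thesis
    by (auto simp: accepts_within_def rejects_within_def com_tm_def)
qed

end

lemma poly_time_solvable_by_com:
  assumes "tapes c \<subseteq> {..<k}" "0 < k" "Halt True \<in> residuals c" "Halt False \<in> residuals c"
    and run: "\<And>x. x \<in> I \<Longrightarrow>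
      \<exists>s. (tape_run.small (enc x) (length (enc x) + b))\<^sup>*\<^sup>* (c, \<lambda>_. 0) (Halt (yes x), s)"
  shows "poly_time_solvable I enc yes"
proof -
  define D where "D = residuals c"
  obtain f where "bij_betw f D {..<card D}"
    using ex_bij_betw_finite_nat[OF finite_residuals, of c] by (auto simp: D_def atLeast0LessThan)
  then interpret com_machine k f D c
    using assms by unfold_locales (auto simp: D_def)
  \<comment> \<open>The number of configurations as a polynomial in the input length;
    \<open>b\<close> is the constant number of cells allowed beyond the input.\<close>
  define p where "p = [:card D:] * [:Suc b, 1:] ^ k"
  have "card D * Suc (length (enc x) + b) ^ k \<le> poly p (length (enc x))" for x
    by (simp add: p_def algebra_simps)
  then show ?thesis
    using run accepts_rejects wf_T unfolding poly_time_solvable_def by (metis (no_types, lifting))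
qed

section \<open>Weakest preconditions\<close>

abbreviation inc :: "nat \<Rightarrow> com" where "inc t \<equiv> Move t MoveRight"
abbreviation dec :: "nat \<Rightarrow> com" where "dec t \<equiv> Move t MoveLeft"
abbreviation nonzero :: "nat set" where "nonzero \<equiv> - {1}"

definition zero :: "nat \<Rightarrow> com" where
  "zero x = While x nonzero (dec x)"

definition set_one :: "nat \<Rightarrow> com" where
  "set_one x = zero x ;; inc x"

text \<open>
  The end marker is read exactly in cell 0, also on the input tape, so it serves as the zero test.
  Tape 1 is the scratch counter of all macros.
\<close>

definition add_to :: "nat \<Rightarrow> nat \<Rightarrow> com" where
  "add_to y x = zero 1 ;; While x nonzero (dec x ;; inc y ;; inc 1) ;; While 1 nonzero (dec 1 ;; inc x)"

definition copy :: "nat \<Rightarrow> nat \<Rightarrow> com" where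
  "copy y x = zero y ;; add_to y x"

text \<open>A left move in cell 0 has no effect, which is precisely truncated subtraction. A zero
  result in \<open>z\<close> therefore tests whether \<open>y\<close> is at most
  \<open>x\<close>.\<close>

definition sub :: "nat \<Rightarrow> nat \<Rightarrow> nat \<Rightarrow> nat \<Rightarrow> com" where
  "sub u z y x = copy z y ;; copy u x ;; While u nonzero (dec u ;; dec z)"

text \<open>Two counters are kept because only tests for zero are available: \<open>t\<close> counts
  the remaining rounds down while \<open>x\<close> provides the index counting up.\<close>

definition for_loop :: "nat \<Rightarrow> nat \<Rightarrow> nat \<Rightarrow> com \<Rightarrow> com" where
  "for_loop t x y body = copy t y ;; zero x ;; While t nonzero (body ;; inc x ;; dec t)"

context tape_run
begin

lemma sym_one_iff: "sym s t = Suc 0 \<longleftrightarrow> s t = 0"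
  by (auto simp: tape_content_def input_tape_def blank_tape_def)

text \<open>Total correctness: a big-step derivation witnesses termination and also that no move on
  the way ends beyond cell \<open>B\<close>.\<close>

definition wp :: "com \<Rightarrow> ((nat \<Rightarrow> nat) \<Rightarrow> bool) \<Rightarrow> (nat \<Rightarrow> nat) \<Rightarrow> bool" where
  "wp c Q s \<longleftrightarrow> (\<exists>s'. big c s s' \<and> Q s')"

lemma wp_mono: "wp c Q s \<Longrightarrow> (\<And>s'. Q s' \<Longrightarrow> Q' s') \<Longrightarrow> wp c Q' s"
  by (auto simp: wp_def)

lemma wp_unmoved: "wp c Q s \<Longrightarrow> v \<notin> moved c \<Longrightarrow> wp c (\<lambda>s'. Q s' \<and> s' v = s v) s"
  using big_unmoved by (fastforce simp: wp_def)

lemma wp_Skip: "Q s \<Longrightarrow> wp Skip Q s"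
  by (auto simp: wp_def intro: big_Skip)

lemma wp_Move: "move_head d (s t) \<le> B \<Longrightarrow> Q (s(t := move_head d (s t))) \<Longrightarrow> wp (Move t d) Q s"
  by (auto simp: wp_def intro: big_Move)

lemma wp_inc: "s t < B \<Longrightarrow> Q (s(t := Suc (s t))) \<Longrightarrow> wp (inc t) Q s"
  by (rule wp_Move) auto

lemma wp_dec: "s t \<le> B \<Longrightarrow> Q (s(t := s t - 1)) \<Longrightarrow> wp (dec t) Q s"
  by (rule wp_Move) auto

lemma wp_Seq: "wp a (wp b Q) s \<Longrightarrow> wp (a ;; b) Q s"
  by (auto simp: wp_def intro: big_Seq)

lemma wp_If:
  "(sym s t \<in> S \<Longrightarrow> wp a Q s) \<Longrightarrow> (sym s t \<notin> S \<Longrightarrow> wp b Q s) \<Longrightarrow> wp (If t S a b) Q s"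
  unfolding wp_def by (cases "sym s t \<in> S") (blast intro: big_IfT big_IfF)+

lemma wp_If_zero:
  "(s t = 0 \<Longrightarrow> wp a Q s) \<Longrightarrow> (s t \<noteq> 0 \<Longrightarrow> wp b Q s) \<Longrightarrow> wp (If t {1} a b) Q s"
  by (rule wp_If) (auto simp: sym_one_iff)

lemma wp_While:
  fixes \<mu> :: "(nat \<Rightarrow> nat) \<Rightarrow> nat"
  assumes "I s"
    and step: "\<And>s. I s \<Longrightarrow> sym s t \<in> S \<Longrightarrow> wp a (\<lambda>s'. I s' \<and> \<mu> s' < \<mu> s) s"
    and exit: "\<And>s. I s \<Longrightarrow> sym s t \<notin> S \<Longrightarrow> Q s"
  shows "wp (While t S a) Q s"
  using assms(1)
proof (induction "\<mu> s" arbitrary: s rule: less_induct)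
  case less
  show ?case
  proof (cases "sym s t \<in> S")
    case True
    then obtain s' where s': "big a s s'" "I s'" "\<mu> s' < \<mu> s"
      using step[OF less.prems] by (auto simp: wp_def)
    from less.hyps[OF s'(3,2)] show ?thesis
      using big_WhileT[OF True s'(1)] by (auto simp: wp_def)
  next
    case False
    then show ?thesis using exit[OF less.prems] by (auto simp: wp_def intro: big_WhileF)
  qed
qed

lemma wp_While_nonzero:
  fixes \<mu> :: "(nat \<Rightarrow> nat) \<Rightarrow> nat"
  assumes "I s"
    and "\<And>s. I s \<Longrightarrow> s t \<noteq> 0 \<Longrightarrow> wp a (\<lambda>s'. I s' \<and> \<mu> s' < \<mu> s) s"
    and "\<And>s. I s \<Longrightarrow> s t = 0 \<Longrightarrow> Q s"
  shows "wp (While t nonzero a) Q s"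
  using assms by (intro wp_While[where I = I and \<mu> = \<mu>]) (auto simp: sym_one_iff)

lemma wp_zero:
  assumes "s x \<le> B" "Q (s(x := 0))"
  shows "wp (zero x) Q s"
  unfolding zero_def
proof (rule wp_While_nonzero[where I = "\<lambda>s'. s' x \<le> B \<and> s'(x := 0) = s(x := 0)" and \<mu> = "\<lambda>s. s x"])
  fix s' assume "s' x \<le> B \<and> s'(x := 0) = s(x := 0)" "s' x = 0"
  then show "Q s'" using assms by (metis fun_upd_triv)
qed (use assms in \<open>auto intro!: wp_dec\<close>)

lemma wp_set_one:
  assumes "s x \<le> B" "0 < B" "Q (s(x := 1))"
  shows "wp (set_one x) Q s"
  unfolding set_one_def by (rule wp_Seq, rule wp_zero, rule assms, rule wp_inc) (use assms in auto)

text \<open>The first loop drains \<open>x\<close> into both \<open>y\<close> and tape 1, the second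
  restores \<open>x\<close> from tape 1. Taking \<open>y = 0\<close> is allowed, and this is how the
  input head is sent to a computed address.\<close>

lemma wp_add_to:
  assumes "x \<noteq> y" "x \<noteq> 1" "y \<noteq> 1" "s 1 \<le> B" "s y + s x \<le> B"
    and Q: "Q (s(1 := 0, y := s y + s x))"
  shows "wp (add_to y x) Q s"
proof -
  define n where "n = s x"
  define s1 where "s1 = s(1 := n, x := 0, y := s y + n)"
  have "wp (While x nonzero (dec x ;; inc y ;; inc 1)) (\<lambda>s'. s' = s1) (s(1 := 0))"
  proof (rule wp_While_nonzero[where \<mu> = "\<lambda>s'. s' x" and
        I = "\<lambda>s'. \<exists>k\<le>n. s' = s(1 := k, x := n - k, y := s y + k)"])
    show "\<exists>k\<le>n. s(1 := 0) = s(1 := k, x := n - k, y := s y + k)"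
      by (rule exI[of _ 0]) (use assms in \<open>simp add: n_def fun_eq_iff\<close>)
  next
    fix s' assume "\<exists>k\<le>n. s' = s(1 := k, x := n - k, y := s y + k)" "s' x \<noteq> 0"
    then obtain k where k: "k < n" "s' = s(1 := k, x := n - k, y := s y + k)"
      using assms by (auto simp: le_less)
    show "wp (dec x ;; inc y ;; inc 1) (\<lambda>s''. (\<exists>k\<le>n. s'' = s(1 := k, x := n - k, y := s y + k))
      \<and> s'' x < s' x) s'"
      by (intro wp_Seq wp_dec wp_inc)
        (use k assms in \<open>auto simp: fun_eq_iff n_def[symmetric] intro!: exI[of _ "Suc k"]\<close>)
  qed (use assms in \<open>auto simp: s1_def\<close>)
  moreover have "wp (While 1 nonzero (dec 1 ;; inc x)) Q s1"
  proof (rule wp_While_nonzero[where \<mu> = "\<lambda>s'. s' 1" and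
        I = "\<lambda>s'. \<exists>k\<le>n. s' = s(1 := n - k, x := k, y := s y + n)"])
    show "\<exists>k\<le>n. s1 = s(1 := n - k, x := k, y := s y + n)"
      by (rule exI[of _ 0]) (simp add: s1_def)
  next
    fix s' assume "\<exists>k\<le>n. s' = s(1 := n - k, x := k, y := s y + n)" "s' 1 \<noteq> 0"
    then obtain k where k: "k < n" "s' = s(1 := n - k, x := k, y := s y + n)"
      using assms by (auto simp: le_less)
    show "wp (dec 1 ;; inc x) (\<lambda>s''. (\<exists>k\<le>n. s'' = s(1 := n - k, x := k, y := s y + n))
      \<and> s'' 1 < s' 1) s'"
      by (intro wp_Seq wp_dec wp_inc)
        (use k assms in \<open>auto simp: fun_eq_iff n_def[symmetric] intro!: exI[of _ "Suc k"]\<close>)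
  next
    fix s' assume "\<exists>k\<le>n. s' = s(1 := n - k, x := k, y := s y + n)" "s' 1 = 0"
    then have "s' = s(1 := 0, y := s y + s x)" using assms by (auto simp: n_def fun_eq_iff)
    with Q show "Q s'" by simp
  qed
  ultimately show ?thesis
    unfolding add_to_def by (intro wp_Seq wp_zero) (use assms in \<open>auto elim: wp_mono\<close>)
qed

lemma wp_copy:
  assumes "x \<noteq> y" "x \<noteq> 1" "y \<noteq> 1" "s 1 \<le> B" "s y \<le> B" "s x \<le> B"
    and Q: "Q (s(1 := 0, y := s x))"
  shows "wp (copy y x) Q s"
  unfolding copy_def
  by (rule wp_Seq, rule wp_zero, rule assms, rule wp_add_to) (use assms in \<open>auto simp: fun_upd_twist\<close>)

lemma wp_sub:
  assumes "distinct [u, x, y, z, 1]"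
    and "s 1 \<le> B" "s u \<le> B" "s x \<le> B" "s y \<le> B" "s z \<le> B"
    and Q: "Q (s(1 := 0, u := 0, z := s y - s x))"
  shows "wp (sub u z y x) Q s"
proof -
  have ne: "u \<noteq> x" "u \<noteq> y" "u \<noteq> z" "u \<noteq> 1" "x \<noteq> y" "x \<noteq> z" "x \<noteq> 1" "y \<noteq> z" "y \<noteq> 1" "z \<noteq> 1"
    using assms(1) by auto
  have "wp (While u nonzero (dec u ;; dec z)) Q (s(1 := 0, z := s y, u := s x))"
  proof (rule wp_While_nonzero[where \<mu> = "\<lambda>s'. s' u" and
        I = "\<lambda>s'. \<exists>k\<le>s x. s' = s(1 := 0, u := s x - k, z := s y - k)"])
    show "\<exists>k\<le>s x. s(1 := 0, z := s y, u := s x) = s(1 := 0, u := s x - k, z := s y - k)"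
      by (rule exI[of _ 0]) (use ne in \<open>simp add: fun_eq_iff\<close>)
  next
    fix s' assume "\<exists>k\<le>s x. s' = s(1 := 0, u := s x - k, z := s y - k)" "s' u \<noteq> 0"
    then obtain k where k: "k < s x" "s' = s(1 := 0, u := s x - k, z := s y - k)"
      using ne by (auto simp: le_less)
    have "s x - k \<le> B" "s y - k \<le> B" using assms(4,5) by linarith+
    with k ne show "wp (dec u ;; dec z) (\<lambda>s''. (\<exists>k\<le>s x. s'' = s(1 := 0, u := s x - k, z := s y - k))
      \<and> s'' u < s' u) s'"
      by (intro wp_Seq wp_dec) (auto simp: fun_eq_iff intro!: exI[of _ "Suc k"])
  next
    fix s' assume "\<exists>k\<le>s x. s' = s(1 := 0, u := s x - k, z := s y - k)" "s' u = 0"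
    then have "s' = s(1 := 0, u := 0, z := s y - s x)" using ne by (auto simp: fun_eq_iff)
    with Q show "Q s'" by simp
  qed
  moreover have "s(1 := 0, z := s y, 1 := 0, u := s x) = s(1 := 0, z := s y, u := s x)"
    using ne by (auto simp: fun_eq_iff)
  ultimately show ?thesis
    unfolding sub_def by (intro wp_Seq wp_copy) (use ne assms(2-6) in simp_all)
qed

text \<open>The invariant must not depend on \<open>x\<close> and \<open>t\<close>, because both
  change after the body. That the body preserves \<open>t\<close> is read off from
  \<open>moved\<close>; that it preserves \<open>x\<close> is part of the obligation.\<close>

lemma wp_for_loop:
  assumes "distinct [t, x, y, 1]" "t \<notin> moved body"
    and bounds: "s 1 \<le> B" "s t \<le> B" "s x \<le> B" "s y \<le> B"
    and init: "I 0 (s(1 := 0, t := s y, x := 0))"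
    and insens: "\<And>k s a b. I k s \<Longrightarrow> a \<le> B \<Longrightarrow> b \<le> B \<Longrightarrow> I k (s(x := a, t := b))"
    and step: "\<And>k s'. k < s y \<Longrightarrow> I k s' \<Longrightarrow> s' x = k \<Longrightarrow> s' t \<le> B \<Longrightarrow>
      wp body (\<lambda>s''. I (Suc k) s'' \<and> s'' x = k) s'"
    and exit: "\<And>s'. I (s y) s' \<Longrightarrow> s' x = s y \<Longrightarrow> s' t = 0 \<Longrightarrow> Q s'"
  shows "wp (for_loop t x y body) Q s"
proof -
  have ne: "t \<noteq> x" "t \<noteq> y" "t \<noteq> 1" "x \<noteq> y" "x \<noteq> 1" "y \<noteq> 1"
    using assms(1) by auto
  let ?I = "\<lambda>s'. \<exists>k\<le>s y. I k s' \<and> s' x = k \<and> s' t = s y - k"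
  have "wp (While t nonzero (body ;; inc x ;; dec t)) Q (s(1 := 0, t := s y, x := 0))"
  proof (rule wp_While_nonzero[where \<mu> = "\<lambda>s'. s' t" and I = ?I])
    show "?I (s(1 := 0, t := s y, x := 0))"
      using init ne by (intro exI[of _ 0]) auto
  next
    fix s' assume "?I s'" "s' t \<noteq> 0"
    then obtain k where k: "k < s y" "I k s'" "s' x = k" "s' t = s y - k"
      by (auto simp: le_less)
    have "wp body (\<lambda>s''. (I (Suc k) s'' \<and> s'' x = k) \<and> s'' t = s' t) s'"
      by (rule wp_unmoved[OF step]) (use k bounds assms(2) in auto)
    then show "wp (body ;; inc x ;; dec t) (\<lambda>s''. ?I s'' \<and> s'' t < s' t) s'"
    proof (intro wp_Seq, elim wp_mono)
      fix s'' assume *: "(I (Suc k) s'' \<and> s'' x = k) \<and> s'' t = s' t"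
      moreover have "Suc k \<le> B" "s y - Suc k \<le> B" using k bounds by linarith+
      ultimately have "I (Suc k) (s''(x := Suc k, t := s y - Suc k))" using insens by blast
      then show "wp (inc x ;; dec t) (\<lambda>s''. ?I s'' \<and> s'' t < s' t) s''"
        using * k bounds ne by (intro wp_Seq wp_inc wp_dec) (auto intro!: exI[of _ "Suc k"])
    qed
  qed (use exit in auto)
  then show ?thesis
    unfolding for_loop_def by (intro wp_Seq wp_copy wp_zero) (use ne bounds in simp_all)
qed

end

definition agree :: "nat set \<Rightarrow> (nat \<Rightarrow> nat) \<Rightarrow> (nat \<Rightarrow> nat) \<Rightarrow> bool" where
  "agree A s s' \<longleftrightarrow> (\<forall>v. v \<notin> A \<longrightarrow> s' v = s v)"

lemma agreeD: "agree A s s' \<Longrightarrow> v \<notin> A \<Longrightarrow> s' v = s v"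
  by (simp add: agree_def)

lemma agree_trans: "agree A s s' \<Longrightarrow> agree A' s' s'' \<Longrightarrow> A \<subseteq> C \<Longrightarrow> A' \<subseteq> C \<Longrightarrow> agree C s s''"
  unfolding agree_def by (metis subsetD)

lemma agree_upd: "x \<in> A \<Longrightarrow> agree A s (s'(x := a)) \<longleftrightarrow> agree A s s'"
  by (auto simp: agree_def)

context tape_run
begin

section \<open>Loops with a frame: which tapes may change\<close>

lemma boundedD: "bounded s \<Longrightarrow> s v \<le> B"
  by (simp add: bounded_def)

lemma bounded_upd: "bounded s \<Longrightarrow> a \<le> B \<Longrightarrow> bounded (s(x := a))"
  by (simp add: bounded_def)

lemma wp_bounded: "wp c Q s \<Longrightarrow> bounded s \<Longrightarrow> wp c (\<lambda>s'. Q s' \<and> bounded s') s"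
  using big_small by (auto simp: wp_def)

text \<open>\<open>A\<close> lists the tapes that the body may change. Boundedness and the frame
  condition are carried through the loop here, so that an application needs to supply only the
  specific invariant \<open>J\<close>.\<close>

lemma wp_for:
  assumes dist: "distinct [t, x, y, 1]" and t: "t \<notin> moved body" and x: "x \<notin> A" and s: "bounded s"
    and init: "\<And>s'. agree {1, t, x} s s' \<Longrightarrow> J 0 s'"
    and insens: "\<And>k s' a b. J k s' \<Longrightarrow> J k (s'(x := a, t := b))"
    and step: "\<And>k s'. k < s y \<Longrightarrow> bounded s' \<Longrightarrow> agree (A \<union> {1, t, x}) s s' \<Longrightarrow> s' x = k \<Longrightarrow> J k s' \<Longrightarrow>
      wp body (\<lambda>s''. agree A s' s'' \<and> J (Suc k) s'') s'"
    and exit: "\<And>s'. bounded s' \<Longrightarrow> agree (A \<union> {1, t, x}) s s' \<Longrightarrow> J (s y) s' \<Longrightarrow> Q s'"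
  shows "wp (for_loop t x y body) Q s"
proof (rule wp_for_loop[where I = "\<lambda>k s'. bounded s' \<and> agree (A \<union> {1, t, x}) s s' \<and> J k s'"])
  have 0: "agree {1, t, x} s (s(1 := 0, t := s y, x := 0))"
    by (simp add: agree_def)
  then show "bounded (s(1 := 0, t := s y, x := 0)) \<and>
      agree (A \<union> {1, t, x}) s (s(1 := 0, t := s y, x := 0)) \<and> J 0 (s(1 := 0, t := s y, x := 0))"
    using init[OF 0] s by (auto simp: bounded_def agree_def)
next
  fix k s' assume k: "k < s y" and I: "bounded s' \<and> agree (A \<union> {1, t, x}) s s' \<and> J k s'" and s'x: "s' x = k"
  have "wp body (\<lambda>s''. (agree A s' s'' \<and> J (Suc k) s'') \<and> bounded s'') s'"
    by (rule wp_bounded[OF step]) (use k I s'x in auto)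
  then show "wp body (\<lambda>s''. (bounded s'' \<and> agree (A \<union> {1, t, x}) s s'' \<and> J (Suc k) s'') \<and> s'' x = k) s'"
    by (rule wp_mono) (use I s'x x in \<open>auto simp: agree_def\<close>)
next
  fix k s' a b assume "bounded s' \<and> agree (A \<union> {1, t, x}) s s' \<and> J k s'" "a \<le> B" "b \<le> B"
  then show "bounded (s'(x := a, t := b)) \<and> agree (A \<union> {1, t, x}) s (s'(x := a, t := b)) \<and>
      J k (s'(x := a, t := b))"
    by (simp add: bounded_upd agree_upd insens)
qed (use assms boundedD[OF s] in auto)

end

section \<open>The program\<close>

text \<open>Tape 0 is the input; the tapes from 19 on hold the temporaries of subtractions and loops.\<close>

abbreviation (input) vR :: nat where "vR \<equiv> 2"
abbreviation (input) vC :: nat where "vC \<equiv> 3"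
abbreviation (input) vI :: nat where "vI \<equiv> 4"
abbreviation (input) vCur :: nat where "vCur \<equiv> 5"
abbreviation (input) vPrev :: nat where "vPrev \<equiv> 6"
abbreviation (input) vNext :: nat where "vNext \<equiv> 7"
abbreviation (input) vK :: nat where "vK \<equiv> 8"
abbreviation (input) vX :: nat where "vX \<equiv> 9"
abbreviation (input) vJ :: nat where "vJ \<equiv> 10"
abbreviation (input) vOk :: nat where "vOk \<equiv> 11"
abbreviation (input) vFound :: nat where "vFound \<equiv> 12"
abbreviation (input) vAdj :: nat where "vAdj \<equiv> 13"
abbreviation (input) vCount :: nat where "vCount \<equiv> 14"
abbreviation (input) vDiff :: nat where "vDiff \<equiv> 15"
abbreviation (input) vQuot :: nat where "vQuot \<equiv> 16"
abbreviation (input) vBit :: nat where "vBit \<equiv> 17"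
abbreviation (input) vLe :: nat where "vLe \<equiv> 18"

text \<open>
  The entry in row \<open>i\<close> and column \<open>j\<close> is in cell \<open>3 + r + c + i * c + j\<close> of the input tape,
  because cell 0 holds the end marker and each unary dimension is closed by one bit.
\<close>

definition lookup :: "nat \<Rightarrow> nat \<Rightarrow> com" where
  "lookup i j = zero 0 ;; inc 0 ;; inc 0 ;; inc 0 ;; add_to 0 vR ;; add_to 0 vC ;;
     for_loop 20 21 i (add_to 0 vC) ;; add_to 0 j"

definition test_common :: com where
  "test_common = zero vAdj ;; for_loop 22 vJ vC
     (lookup vCur vJ ;; If 0 {3} (lookup vX vJ ;; If 0 {3} (set_one vAdj) Skip) Skip)"

text \<open>Two numbers are equal exactly if both truncated differences vanish.\<close>

definition clear_if_eq :: "nat \<Rightarrow> nat \<Rightarrow> nat \<Rightarrow> com" where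
  "clear_if_eq z x y = sub 19 vDiff x y ;;
     If vDiff {1} (sub 19 vDiff y x ;; If vDiff {1} (zero z) Skip) Skip"

text \<open>A nonzero row shares a column with itself, hence the comparison with
  \<open>vCur\<close>; the one with \<open>vPrev\<close> prevents turning back. Later candidates
  overwrite earlier ones, which is harmless because any of them continues the walk.\<close>

definition find_next :: com where
  "find_next = zero vFound ;; for_loop 23 vX vR
     (test_common ;; clear_if_eq vAdj vX vCur ;; clear_if_eq vAdj vX vPrev ;;
      If vAdj {1} Skip (copy vNext vX ;; set_one vFound))"

text \<open>The surrounding loop cannot be left early. After a failure it keeps walking, but no walk
  step sets \<open>vOk\<close> again.\<close>

definition walk_step :: com where
  "walk_step = find_next ;; If vFound {1} (zero vOk)
     (copy vPrev vCur ;; copy vCur vNext ;; sub 19 vDiff vI vCur ;; If vDiff {1} Skip (zero vOk))"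

definition test_row :: com where
  "test_row = copy vCur vI ;; copy vPrev vI ;; set_one vOk ;; for_loop 24 vK vR walk_step ;;
     If vOk {1} Skip (inc vCount)"

definition read_dims :: com where
  "read_dims = inc 0 ;; While 0 {3} (inc 0 ;; inc vR) ;; inc 0 ;; While 0 {3} (inc 0 ;; inc vC)"

definition halve :: com where
  "halve = zero vQuot ;; zero vBit ;;
     While vCount nonzero (dec vCount ;; If vCount {1} (set_one vBit) (dec vCount ;; inc vQuot)) ;;
     copy vCount vQuot"

text \<open>
  With \<open>q\<close> in the counter and \<open>d'\<close> spelled by the rest of the tape, the comparison that is still to
  be decided is \<open>q < d'\<close>, or \<open>q = d'\<close> and the flag is set.
\<close>

definition compare :: com where
  "compare = set_one vLe ;; While 0 {2, 3}
     (halve ;; If 0 {3} (If vBit {1} (set_one vLe) Skip) (If vBit {1} Skip (zero vLe)) ;; inc 0)"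

text \<open>With \<open>vJ\<close> zero, \<open>lookup vR vJ\<close> addresses a fictitious row
  \<open>r\<close> just below the matrix, and this cell is where the bits of \<open>d\<close>
  begin.\<close>

definition count_and_compare :: com where
  "count_and_compare = read_dims ;; for_loop 25 vI vR test_row ;; zero vJ ;; lookup vR vJ ;; compare"

text \<open>Once the bits of \<open>d\<close> are exhausted, the pending comparison is with 0, so
  the answer is yes exactly if the counter is zero and the flag is set.\<close>

definition decide :: com where
  "decide = count_and_compare ;; If vCount {1} (If vLe {1} (Halt False) (Halt True)) (Halt False)"

lemmas program_defs = decide_def count_and_compare_def compare_def halve_def read_dims_def test_row_def
  walk_step_def find_next_def clear_if_eq_def test_common_def lookup_def for_loop_def sub_def copy_def
  add_to_def set_one_def zero_def

lemma tapes_decide: "tapes decide \<subseteq> {..<26}"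
  by (simp add: program_defs)

lemma Halt_decide: "Halt b \<in> residuals decide"
  by (cases b) (simp_all add: decide_def)

context tape_run
begin

text \<open>Only the resulting address is bounded, not the indices \<open>i\<close> and
  \<open>j\<close>, so that the cell behind the last entry can be reached as well.\<close>

lemma wp_lookup:
  assumes s: "bounded s" and ij: "i \<notin> {0, 1, 20, 21}" "j \<notin> {0, 1, 20, 21}"
    and le: "3 + s vR + s vC + s i * s vC + s j \<le> B"
    and Q: "\<And>s'. bounded s' \<Longrightarrow> agree {0, 1, 20, 21} s s' \<Longrightarrow>
      s' 0 = 3 + s vR + s vC + s i * s vC + s j \<Longrightarrow> Q s'"
  shows "wp (lookup i j) Q s"
proof -
  define p where "p = 3 + s vR + s vC"
  define s1 where "s1 = s(1 := 0, 0 := p)"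
  have s1: "bounded s1" using s le by (simp add: s1_def p_def bounded_upd)
  have "wp (for_loop 20 21 i (add_to 0 vC)) (wp (add_to 0 j) Q) s1"
  proof (rule wp_for[where A = "{0, 1}" and J = "\<lambda>k s'. s' 0 = p + k * s vC"])
    show "s' 0 = p + 0 * s vC" if "agree {1, 20, 21} s1 s'" for s'
      using agreeD[OF that, of 0] by (simp add: s1_def)
  next
    fix k s' assume k: "k < s1 i" and s': "bounded s'" "agree ({0, 1} \<union> {1, 20, 21}) s1 s'" "s' 0 = p + k * s vC"
    have "s' vC = s vC" using agreeD[OF s'(2), of vC] by (simp add: s1_def)
    moreover have "Suc k * s vC \<le> s i * s vC" using k ij by (intro mult_le_mono1) (simp add: s1_def)
    ultimately show "wp (add_to 0 vC) (\<lambda>s''. agree {0, 1} s' s'' \<and> s'' 0 = p + Suc k * s vC) s'"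
      using s' le by (intro wp_add_to) (auto simp: boundedD agree_def p_def)
  next
    fix s' assume s': "bounded s'" "agree ({0, 1} \<union> {1, 20, 21}) s1 s'" "s' 0 = p + s1 i * s vC"
    have v: "s' v = s v" if "v \<notin> {0, 1, 20, 21}" for v
      using agreeD[OF s'(2), of v] that by (simp add: s1_def)
    have i: "s1 i = s i" using ij by (simp add: s1_def)
    have sum: "s' 0 + s' j = 3 + s vR + s vC + s i * s vC + s j"
      using s'(3) v[OF ij(2)] i by (simp add: p_def)
    show "wp (add_to 0 j) Q s'"
    proof (rule wp_add_to)
      show "Q (s'(1 := 0, 0 := s' 0 + s' j))"
      proof (rule Q)
        show "bounded (s'(1 := 0, 0 := s' 0 + s' j))"
          using s'(1) sum le by (intro bounded_upd) auto
        show "agree {0, 1, 20, 21} s (s'(1 := 0, 0 := s' 0 + s' j))"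
          using v by (simp add: agree_def)
      qed (use sum in simp)
    qed (use ij sum le s'(1) in \<open>auto simp: boundedD\<close>)
  qed (use ij s1 in \<open>auto simp: add_to_def zero_def\<close>)
  moreover have "s(0 := 0, 0 := Suc 0, 0 := Suc (Suc 0), 0 := Suc (Suc (Suc 0)), 1 := 0,
      0 := 3 + s vR, 1 := 0, 0 := 3 + s vR + s vC) = s1"
    by (simp add: s1_def p_def fun_eq_iff)
  ultimately show ?thesis
    unfolding lookup_def using s le
    by (intro wp_Seq wp_zero wp_inc wp_add_to) (simp_all add: boundedD numeral_3_eq_3 s1_def p_def)
qed

end

section \<open>Correctness of the program\<close>

lemma concat_map_upt_nth:
  assumes "i < r" "j < c"
  shows "i * c + j < r * c"
    and "concat (map (\<lambda>i. map (f i) [0..<c]) [0..<r]) ! (i * c + j) = f i j"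
proof -
  have len: "length (concat (map (\<lambda>i. map (f i) [0..<c]) [0..<n])) = n * c" for n
    by (induction n) auto
  have "Suc i * c \<le> r * c" using assms(1) by (intro mult_le_mono1) simp
  then show "i * c + j < r * c" using assms(2) by simp
  show "concat (map (\<lambda>i. map (f i) [0..<c]) [0..<r]) ! (i * c + j) = f i j"
    using assms
  proof (induction r)
    case (Suc r)
    show ?case
    proof (cases "i < r")
      case True
      then have "Suc i * c \<le> r * c" by (intro mult_le_mono1) simp
      then have "i * c + j < r * c" using Suc.prems by simp
      with Suc True show ?thesis by (simp add: nth_append len)
    next
      case False
      with Suc.prems have "i = r" by simp
      with Suc.prems show ?thesis by (simp add: nth_append len)
    qed
  qed simp
qed

text \<open>The cell \<open>length w + 1\<close> is the first blank behind the input. The head has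
  to reach it to notice the end of \<open>d\<close>.\<close>

locale sc1s_run = tape_run w B for w B +
  fixes M :: "nat mat" and d :: nat
  assumes M: "xy_matrix 2 2 M" and w: "w = encode_instance (M, d)" and B: "B = length w + 1"
begin

abbreviation "r \<equiv> dim_row M"
abbreviation "c \<equiv> dim_col M"
abbreviation "E \<equiv> row_adj M"

section \<open>Layout of the input tape\<close>

definition entries :: "bool list" where
  "entries = concat (map (\<lambda>i. map (\<lambda>j. M $$ (i, j) = 1) [0..<c]) [0..<r])"

lemma w_split:
  "w = replicate r True @ False # replicate c True @ False # entries @ binary d"
  by (simp add: w encode_instance_def encode_mat_def entries_def)

lemma length_entries: "length entries = r * c"
  by (simp add: entries_def length_concat o_def sum_list_triv)

lemma B_eq: "B = 3 + r + c + r * c + length (binary d)"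
  unfolding B by (subst w_split) (simp add: length_entries)

lemma input_content: "tape_content w 0 (Suc p) = (if p < length w then if w ! p then 3 else 2 else 0)"
  by (simp add: tape_content_def input_tape_def Suc_le_eq)

lemma content_rows: "p < r \<Longrightarrow> tape_content w 0 (Suc p) = 3"
  unfolding input_content by (subst (1 2) w_split) (simp add: nth_append)

lemma content_rows_end: "tape_content w 0 (Suc r) = 2"
  unfolding input_content by (subst (1 2) w_split) (simp add: nth_append)

lemma content_cols: "p < c \<Longrightarrow> tape_content w 0 (r + 2 + p) = 3"
  using input_content[of "Suc r + p"] by (subst (asm) (2 3) w_split) (simp add: nth_append nth_Cons)

lemma content_cols_end: "tape_content w 0 (r + 2 + c) = 2"
  using input_content[of "Suc r + c"] by (subst (asm) (2 3) w_split) (simp add: nth_append nth_Cons)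

lemma content_entry:
  assumes "i < r" "j < c"
  shows "tape_content w 0 (3 + r + c + i * c + j) = (if M $$ (i, j) = 1 then 3 else 2)"
proof -
  have w': "w = (replicate r True @ False # replicate c True @ [False]) @ entries @ binary d" (is "w = ?a @ ?b @ ?c")
    by (subst w_split) simp
  have "length ?a = 2 + r + c" by simp
  moreover have "i * c + j < r * c" "?b ! (i * c + j) = (M $$ (i, j) = 1)"
    using concat_map_upt_nth(1)[OF assms]
      concat_map_upt_nth(2)[OF assms, where f = "\<lambda>i j. M $$ (i, j) = 1"]
    by (simp_all add: entries_def)
  ultimately have "2 + r + c + i * c + j < length w" "w ! (2 + r + c + i * c + j) = (M $$ (i, j) = 1)"
    unfolding w' by (simp_all only: nth_append length_append length_entries) auto
  then show ?thesis using input_content[of "2 + r + c + i * c + j"] by (simp add: numeral_3_eq_3)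
qed

text \<open>All cells from \<open>p\<close> on are fixed, including the blanks behind
  \<open>bs\<close>, so the end of the number can be recognised.\<close>

definition spells :: "nat \<Rightarrow> bool list \<Rightarrow> bool" where
  "spells p bs \<longleftrightarrow> (\<forall>m. tape_content w 0 (p + m) = (if m < length bs then if bs ! m then 3 else 2 else 0))"

lemma spells_Nil: "spells p [] \<Longrightarrow> tape_content w 0 p = 0"
  by (simp add: spells_def) (metis add.right_neutral)

lemma spells_Cons: "spells p (b # bs) \<Longrightarrow> tape_content w 0 p = (if b then 3 else 2) \<and> spells (Suc p) bs"
  unfolding spells_def
  by (intro conjI allI; drule spec[of _ 0] spec[of _ "Suc _"]) (auto split: if_splits)

lemma spells_binary_d: "spells (3 + r + c + r * c) (binary d)"
proof -
  have w': "w = (replicate r True @ False # replicate c True @ [False] @ entries) @ binary d" (is "w = ?a @ ?c")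
    by (subst w_split) simp
  have len: "length ?a = 2 + r + c + r * c" by (simp add: length_entries)
  have "2 + r + c + r * c + m < length w \<longleftrightarrow> m < length (binary d)" for m
    by (subst w') (simp add: length_entries)
  moreover have "w ! (2 + r + c + r * c + m) = binary d ! m" for m
    by (subst w', simp only: nth_append len) simp
  ultimately show ?thesis
    unfolding spells_def using input_content[of "2 + r + c + r * c + _"] by (simp add: numeral_3_eq_3)
qed

lemma wp_halve:
  assumes s: "bounded s" and "0 < B"
    and Q: "\<And>s'. bounded s' \<Longrightarrow> agree {1, vCount, vQuot, vBit} s s' \<Longrightarrow>
      s' vCount = s vCount div 2 \<Longrightarrow> s' vBit = s vCount mod 2 \<Longrightarrow> Q s'"
  shows "wp halve Q s"
proof -
  \<comment> \<open>The bit is set only when a single unit was left, that is, in the last round;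
    hence the final implication in the invariant.\<close>
  let ?I = "\<lambda>s'. bounded s' \<and> agree {vCount, vQuot, vBit} s s' \<and> s' vCount + 2 * s' vQuot + s' vBit = s vCount
    \<and> s' vBit \<le> 1 \<and> (s' vBit = 1 \<longrightarrow> s' vCount = 0)"
  have "wp (While vCount nonzero (dec vCount ;; If vCount {1} (set_one vBit) (dec vCount ;; inc vQuot)))
    (wp (copy vCount vQuot) Q) (s(vQuot := 0, vBit := 0))"
  proof (rule wp_While_nonzero[where I = ?I and \<mu> = "\<lambda>s'. s' vCount"])
    show "?I (s(vQuot := 0, vBit := 0))"
      using s by (simp add: bounded_upd agree_def)
  next
    fix s' assume I: "?I s'" and nz: "s' vCount \<noteq> 0"
    have le: "s' vCount \<le> B" "s' vQuot \<le> B" "s' vBit \<le> B" "s vCount \<le> B"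
      using I s by (auto simp: boundedD)
    have lt: "s' vQuot < B" using I nz le by linarith
    have "s' vBit = 0" using I nz by linarith
    then show "wp (dec vCount ;; If vCount {1} (set_one vBit) (dec vCount ;; inc vQuot))
        (\<lambda>s''. ?I s'' \<and> s'' vCount < s' vCount) s'"
      using I nz le lt \<open>0 < B\<close>
      by (intro wp_Seq wp_dec wp_If_zero wp_set_one wp_inc)
         (auto simp: bounded_upd agree_upd)
  next
    fix s' assume I: "?I s'" and z: "s' vCount = 0"
    then have eq: "s vCount = 2 * s' vQuot + s' vBit" "s' vBit < 2" by auto
    then have "s vCount div 2 = s' vQuot" "s vCount mod 2 = s' vBit" by auto
    then show "wp (copy vCount vQuot) Q s'"
      using I boundedD[OF s] by (intro wp_copy Q) (auto simp: boundedD bounded_upd agree_def)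
  qed
  then show ?thesis
    unfolding halve_def using s by (intro wp_Seq wp_zero) (simp_all add: boundedD)
qed

lemma wp_compare:
  assumes s: "bounded s" and p: "s 0 = 3 + r + c + r * c"
    and Q: "\<And>s'. (s' vCount = 0 \<and> s' vLe \<noteq> 0) = (s vCount \<le> d) \<Longrightarrow> Q s'"
  shows "wp compare Q s"
proof -
  have "0 < B" by (simp add: B)
  \<comment> \<open>\<open>d'\<close> is the part of \<open>d\<close> still unread. The flag records
    whether the low bits already split off from the count are at most the low bits already read from
    \<open>d\<close>.\<close>
  let ?I = "\<lambda>s'. bounded s' \<and> (\<exists>d'. spells (s' 0) (binary d') \<and> s' 0 + length (binary d') \<le> B \<and>
    (s' vCount < d' \<or> s' vCount = d' \<and> s' vLe \<noteq> 0) = (s vCount \<le> d))"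
  have "wp (While 0 {2, 3} (halve ;;
      If 0 {3} (If vBit {1} (set_one vLe) Skip) (If vBit {1} Skip (zero vLe)) ;; inc 0)) Q (s(vLe := 1))"
  proof (rule wp_While[where I = ?I and \<mu> = "\<lambda>s'. B - s' 0"])
    show "?I (s(vLe := 1))"
    proof -
      have "3 + r + c + r * c + length (binary d) \<le> B" by (simp add: B_eq)
      then show ?thesis
        using s p spells_binary_d \<open>0 < B\<close> by (auto simp: bounded_upd intro!: exI[of _ d])
    qed
  next
    fix s' assume "?I s'" and sym: "sym s' 0 \<in> {2, 3}"
    then obtain d' where s': "bounded s'" and sp: "spells (s' 0) (binary d')" "s' 0 + length (binary d') \<le> B"
      and cmp: "(s' vCount < d' \<or> s' vCount = d' \<and> s' vLe \<noteq> 0) = (s vCount \<le> d)" by blast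
    have "d' \<noteq> 0"
    proof
      assume "d' = 0"
      then have "spells (s' 0) []" using sp(1) binary.simps[of 0] by simp
      then show False using sym spells_Nil by fastforce
    qed
    then have bin: "binary d' = odd d' # binary (d' div 2)"
      using binary.simps[of d'] by simp
    have sp': "sym s' 0 = (if odd d' then 3 else 2)" "spells (Suc (s' 0)) (binary (d' div 2))"
      "Suc (s' 0) + length (binary (d' div 2)) \<le> B"
      using spells_Cons[of "s' 0"] sp bin by auto
    show "wp (halve ;; If 0 {3} (If vBit {1} (set_one vLe) Skip) (If vBit {1} Skip (zero vLe)) ;; inc 0)
        (\<lambda>s''. ?I s'' \<and> B - s'' 0 < B - s' 0) s'"
    proof (rule wp_Seq, rule wp_halve[OF s' \<open>0 < B\<close>])
      fix s1 assume s1: "bounded s1" "agree {1, vCount, vQuot, vBit} s' s1"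
        "s1 vCount = s' vCount div 2" "s1 vBit = s' vCount mod 2"
      have v: "s1 0 = s' 0" "s1 vLe = s' vLe" using s1(2) by (auto simp: agree_def)
      \<comment> \<open>Bits arrive with increasing weight, so the new bit decides the flag unless
        the two bits agree, in which case the old flag stays.\<close>
      have fin: "wp (inc 0) (\<lambda>s''. ?I s'' \<and> B - s'' 0 < B - s' 0) s2"
        if s2: "bounded s2" "s2 0 = s' 0" "s2 vCount = s' vCount div 2"
          and le: "s2 vLe \<noteq> 0 \<longleftrightarrow> s' vCount mod 2 < d' mod 2 \<or> s' vCount mod 2 = d' mod 2 \<and> s' vLe \<noteq> 0"
        for s2
      proof (rule wp_inc)
        show "s2 0 < B" using s2 sp' by simp
        have "(s2 vCount < d' div 2 \<or> s2 vCount = d' div 2 \<and> s2 vLe \<noteq> 0) = (s vCount \<le> d)"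
          unfolding cmp[symmetric] le s2(3)
          using div_mult_mod_eq[of d' 2] div_mult_mod_eq[of "s' vCount" 2]
            mod_less_divisor[of 2 d'] mod_less_divisor[of 2 "s' vCount"] by linarith
        then show "?I (s2(0 := Suc (s2 0))) \<and> B - (s2(0 := Suc (s2 0))) 0 < B - s' 0"
          using s2 sp' by (auto simp: bounded_upd intro!: exI[of _ "d' div 2"])
      qed
      have s1': "sym s1 0 = (if odd d' then 3 else 2)" using sp'(1) v by simp
      show "wp (If 0 {3} (If vBit {1} (set_one vLe) Skip) (If vBit {1} Skip (zero vLe)) ;; inc 0)
          (\<lambda>s''. ?I s'' \<and> B - s'' 0 < B - s' 0) s1"
        using s1 v s1' \<open>0 < B\<close> boundedD[OF s', of vLe]
        by (intro wp_Seq wp_If[where t = 0] wp_If_zero wp_set_one wp_zero wp_Skip fin)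
           (auto simp: boundedD bounded_upd odd_iff_mod_2_eq_one split: if_splits)
    qed
  next
    fix s' assume "?I s'" and sym: "sym s' 0 \<notin> {2, 3}"
    then obtain d' where sp: "spells (s' 0) (binary d')"
      and cmp: "(s' vCount < d' \<or> s' vCount = d' \<and> s' vLe \<noteq> 0) = (s vCount \<le> d)" by blast
    have "d' = 0"
    proof (rule ccontr)
      assume "d' \<noteq> 0"
      then have "binary d' = odd d' # binary (d' div 2)" using binary.simps[of d'] by simp
      then show False using spells_Cons[of "s' 0"] sp sym by (auto split: if_splits)
    qed
    then show "Q s'" using cmp by (intro Q) auto
  qed
  then show ?thesis
    unfolding compare_def using s \<open>0 < B\<close> by (intro wp_Seq wp_set_one) (simp_all add: boundedD)
qed

lemma wp_read_dims:
  assumes "Q ((\<lambda>_. 0)(vR := r, vC := c, 0 := r + 2 + c))"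
  shows "wp read_dims Q (\<lambda>_. 0)"
proof -
  let ?s1 = "\<lambda>k. (\<lambda>_. 0)(vR := k, 0 := Suc k)"
  let ?s2 = "\<lambda>k. (\<lambda>_. 0)(vR := r, vC := k, 0 := r + 2 + k)"
  have 2: "wp (While 0 {3} (inc 0 ;; inc vC)) Q (?s2 0)"
  proof (rule wp_While[where I = "\<lambda>s. \<exists>k\<le>c. s = ?s2 k" and \<mu> = "\<lambda>s. c - s vC"])
    fix s assume "\<exists>k\<le>c. s = ?s2 k" and sym: "sym s 0 \<in> {3}"
    then obtain k where k: "k < c" "s = ?s2 k"
      using content_cols_end by (auto simp: le_less)
    then show "wp (inc 0 ;; inc vC) (\<lambda>s'. (\<exists>k\<le>c. s' = ?s2 k) \<and> c - s' vC < c - s vC) s"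
      by (intro wp_Seq wp_inc) (auto simp: B_eq fun_eq_iff intro!: exI[of _ "Suc k"])
  next
    fix s assume "\<exists>k\<le>c. s = ?s2 k" "sym s 0 \<notin> {3}"
    then have "s = ?s2 c" using content_cols by (auto simp: le_less)
    then show "Q s" using assms by simp
  qed auto
  have "wp (While 0 {3} (inc 0 ;; inc vR)) (wp (inc 0 ;; While 0 {3} (inc 0 ;; inc vC)) Q) (?s1 0)"
  proof (rule wp_While[where I = "\<lambda>s. \<exists>k\<le>r. s = ?s1 k" and \<mu> = "\<lambda>s. r - s vR"])
    fix s assume "\<exists>k\<le>r. s = ?s1 k" and sym: "sym s 0 \<in> {3}"
    then obtain k where k: "k < r" "s = ?s1 k"
      using content_rows_end by (auto simp: le_less)
    then show "wp (inc 0 ;; inc vR) (\<lambda>s'. (\<exists>k\<le>r. s' = ?s1 k) \<and> r - s' vR < r - s vR) s"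
      by (intro wp_Seq wp_inc) (auto simp: B_eq fun_eq_iff intro!: exI[of _ "Suc k"])
  next
    fix s assume "\<exists>k\<le>r. s = ?s1 k" "sym s 0 \<notin> {3}"
    then have s: "s = ?s1 r" using content_rows by (auto simp: le_less)
    then have "s(0 := Suc (s 0)) = ?s2 0" by (auto simp: fun_eq_iff)
    then show "wp (inc 0 ;; While 0 {3} (inc 0 ;; inc vC)) Q s"
      using 2 s by (intro wp_Seq wp_inc) (simp_all add: B_eq)
  qed auto
  moreover have "(\<lambda>_. 0)(0 := Suc 0) = ?s1 0" by (auto simp: fun_eq_iff)
  ultimately show ?thesis
    unfolding read_dims_def by (intro wp_Seq wp_inc) (simp_all add: B_eq)
qed

end

context sc1s_run
begin

section \<open>Verification of the cycle count\<close>

lemma B_pos: "0 < B"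
  by (simp add: B)

lemma wp_lookup_entry:
  assumes "bounded s" "i \<notin> {0, 1, 20, 21}" "j \<notin> {0, 1, 20, 21}"
    and dims: "s vR = r" "s vC = c" and ij: "s i < r" "s j < c"
    and Q: "\<And>s'. bounded s' \<Longrightarrow> agree {0, 1, 20, 21} s s' \<Longrightarrow>
      sym s' 0 = (if M $$ (s i, s j) = 1 then 3 else 2) \<Longrightarrow> Q s'"
  shows "wp (lookup i j) Q s"
proof (rule wp_lookup)
  show "3 + s vR + s vC + s i * s vC + s j \<le> B"
    using concat_map_upt_nth(1)[OF ij] dims by (simp add: B_eq)
  fix s' assume "bounded s'" "agree {0, 1, 20, 21} s s'" "s' 0 = 3 + s vR + s vC + s i * s vC + s j"
  then show "Q s'" using content_entry[OF ij] dims by (intro Q) simp_all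
qed (use assms in auto)

lemma wp_test_common:
  assumes s: "bounded s" "s vR = r" "s vC = c" "s vCur < r" "s vX < r"
    and Q: "\<And>s'. bounded s' \<Longrightarrow> agree {0, 1, vJ, vAdj, 20, 21, 22} s s' \<Longrightarrow>
      s' vAdj \<noteq> 0 \<longleftrightarrow> (\<exists>j<c. M $$ (s vCur, j) = 1 \<and> M $$ (s vX, j) = 1) \<Longrightarrow> Q s'"
  shows "wp test_common Q s"
proof -
  let ?P = "\<lambda>j. M $$ (s vCur, j) = 1 \<and> M $$ (s vX, j) = 1"
  let ?J = "\<lambda>k s'. s' vAdj \<noteq> 0 \<longleftrightarrow> (\<exists>j<k. ?P j)"
  have ex_Suc: "(\<exists>j<Suc k. ?P j) \<longleftrightarrow> (\<exists>j<k. ?P j) \<or> ?P k" for k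
    by (auto simp: less_Suc_eq)
  have "wp (for_loop 22 vJ vC
      (lookup vCur vJ ;; If 0 {3} (lookup vX vJ ;; If 0 {3} (set_one vAdj) Skip) Skip)) Q (s(vAdj := 0))"
  proof (rule wp_for[where A = "{0, 1, vAdj, 20, 21}" and J = ?J])
    show "?J 0 s'" if "agree {1, 22, vJ} (s(vAdj := 0)) s'" for s'
      using agreeD[OF that, of vAdj] by simp
  next
    fix k s' assume k: "k < (s(vAdj := 0)) vC" and s': "bounded s'"
      "agree ({0, 1, vAdj, 20, 21} \<union> {1, 22, vJ}) (s(vAdj := 0)) s'" "s' vJ = k" "?J k s'"
    have v: "s' vR = r" "s' vC = c" "s' vCur = s vCur" "s' vX = s vX"
      using s'(2) s by (simp_all add: agree_def)
    have kc: "k < c" using k s by simp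
    have skip: "agree {0, 1, vAdj, 20, 21} s' s'' \<and> ?J (Suc k) s''"
      if "agree {0, 1, 20, 21} s' s''" "\<not> ?P k" for s''
      using that s'(4) agreeD[OF that(1), of vAdj] unfolding ex_Suc by (auto simp: agree_def)
    show "wp (lookup vCur vJ ;; If 0 {3} (lookup vX vJ ;; If 0 {3} (set_one vAdj) Skip) Skip)
        (\<lambda>s''. agree {0, 1, vAdj, 20, 21} s' s'' \<and> ?J (Suc k) s'') s'"
    proof (rule wp_Seq, rule wp_lookup_entry)
      fix s1 assume s1: "bounded s1" "agree {0, 1, 20, 21} s' s1"
        "sym s1 0 = (if M $$ (s' vCur, s' vJ) = 1 then 3 else 2)"
      have v1: "s1 vR = r" "s1 vC = c" "s1 vX = s vX" "s1 vJ = k"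
        using s1(2) v s'(3) by (simp_all add: agree_def)
      show "wp (If 0 {3} (lookup vX vJ ;; If 0 {3} (set_one vAdj) Skip) Skip)
          (\<lambda>s''. agree {0, 1, vAdj, 20, 21} s' s'' \<and> ?J (Suc k) s'') s1"
      proof (rule wp_If)
        assume "sym s1 0 \<in> {3}"
        then have one: "M $$ (s vCur, k) = 1" using s1(3) v s'(3) by (simp split: if_splits)
        show "wp (lookup vX vJ ;; If 0 {3} (set_one vAdj) Skip)
            (\<lambda>s''. agree {0, 1, vAdj, 20, 21} s' s'' \<and> ?J (Suc k) s'') s1"
        proof (rule wp_Seq, rule wp_lookup_entry)
          fix s2 assume s2: "bounded s2" "agree {0, 1, 20, 21} s1 s2"
            "sym s2 0 = (if M $$ (s1 vX, s1 vJ) = 1 then 3 else 2)"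
          have ag: "agree {0, 1, 20, 21} s' s2" by (rule agree_trans[OF s1(2) s2(2)]) auto
          show "wp (If 0 {3} (set_one vAdj) Skip)
              (\<lambda>s''. agree {0, 1, vAdj, 20, 21} s' s'' \<and> ?J (Suc k) s'') s2"
          proof (rule wp_If)
            assume "sym s2 0 \<in> {3}"
            then have "?P k" using s2(3) v1 one by (simp split: if_splits)
            then have "?J (Suc k) (s2(vAdj := 1))" unfolding ex_Suc by simp
            moreover have "agree {0, 1, vAdj, 20, 21} s' (s2(vAdj := 1))"
              using ag by (simp add: agree_def)
            ultimately show "wp (set_one vAdj)
                (\<lambda>s''. agree {0, 1, vAdj, 20, 21} s' s'' \<and> ?J (Suc k) s'') s2"
              using s2(1) by (intro wp_set_one) (simp_all add: boundedD B_pos Suc_leI)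
          next
            assume "sym s2 0 \<notin> {3}"
            then have "\<not> ?P k" using s2(3) v1 by (auto split: if_splits)
            then show "wp Skip (\<lambda>s''. agree {0, 1, vAdj, 20, 21} s' s'' \<and> ?J (Suc k) s'') s2"
              by (intro wp_Skip skip[OF ag])
          qed
        qed (use s1 v1 kc s in auto)
      next
        assume "sym s1 0 \<notin> {3}"
        then have "\<not> ?P k" using s1(3) v s'(3) by (auto split: if_splits)
        then show "wp Skip (\<lambda>s''. agree {0, 1, vAdj, 20, 21} s' s'' \<and> ?J (Suc k) s'') s1"
          by (intro wp_Skip skip[OF s1(2)])
      qed
    qed (use s' v kc s in auto)
  next
    fix s' assume s': "bounded s'" "agree ({0, 1, vAdj, 20, 21} \<union> {1, 22, vJ}) (s(vAdj := 0)) s'"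
      "?J ((s(vAdj := 0)) vC) s'"
    have "agree {0, 1, vJ, vAdj, 20, 21, 22} s s'" using s'(2) by (auto simp: agree_def)
    then show "Q s'" using s' s by (intro Q) auto
  qed (use s in \<open>auto simp: bounded_upd lookup_def for_loop_def copy_def add_to_def zero_def set_one_def\<close>)
  then show ?thesis
    unfolding test_common_def using s by (intro wp_Seq wp_zero) (simp_all add: boundedD)
qed

lemma wp_clear_if_eq:
  assumes s: "bounded s" and dist: "distinct [x, y, z, 1, 19, vDiff]"
    and Q: "\<And>s'. bounded s' \<Longrightarrow> agree {1, 19, vDiff, z} s s' \<Longrightarrow>
      s' z = (if s x = s y then 0 else s z) \<Longrightarrow> Q s'"
  shows "wp (clear_if_eq z x y) Q s"
proof -
  have b: "s v \<le> B" "s u - s v \<le> B" for u v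
    using boundedD[OF s, of v] boundedD[OF s, of u] by auto
  show ?thesis
    unfolding clear_if_eq_def
    by (intro wp_Seq wp_sub wp_If_zero wp_zero wp_Skip Q)
       (use dist s b in \<open>auto simp: bounded_upd agree_def\<close>)
qed

abbreviation find_moved :: "nat set" where
  "find_moved \<equiv> {0, 1, vNext, vX, vJ, vFound, vAdj, vDiff, 19, 20, 21, 22, 23}"

lemma wp_find_next:
  assumes s: "bounded s" "s vR = r" "s vC = c" "s vCur < r"
    and Q: "\<And>s'. bounded s' \<Longrightarrow> agree find_moved s s' \<Longrightarrow>
      (s' vFound = 0 \<longrightarrow> (\<forall>x. E (s vCur) x \<longrightarrow> x = s vPrev)) \<Longrightarrow>
      (s' vFound \<noteq> 0 \<longrightarrow> E (s vCur) (s' vNext) \<and> s' vNext \<noteq> s vPrev) \<Longrightarrow> Q s'"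
  shows "wp find_next Q s"
proof -
  let ?A = "{0, 1, vNext, vJ, vFound, vAdj, vDiff, 19, 20, 21, 22}"
  let ?J = "\<lambda>k s'. (s' vFound = 0 \<longrightarrow> (\<forall>x<k. E (s vCur) x \<longrightarrow> x = s vPrev)) \<and>
    (s' vFound \<noteq> 0 \<longrightarrow> E (s vCur) (s' vNext) \<and> s' vNext \<noteq> s vPrev)"
  have "wp (for_loop 23 vX vR
      (test_common ;; clear_if_eq vAdj vX vCur ;; clear_if_eq vAdj vX vPrev ;;
       If vAdj {1} Skip (copy vNext vX ;; set_one vFound))) Q (s(vFound := 0))"
  proof (rule wp_for[where A = ?A and J = ?J])
    show "?J 0 s'" if "agree {1, 23, vX} (s(vFound := 0)) s'" for s'
      using agreeD[OF that, of vFound] by simp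
  next
    fix k s' assume k: "k < (s(vFound := 0)) vR" and s': "bounded s'"
      "agree (?A \<union> {1, 23, vX}) (s(vFound := 0)) s'" "s' vX = k" "?J k s'"
    have v: "s' vR = r" "s' vC = c" "s' vCur = s vCur" "s' vPrev = s vPrev"
      using s'(2) s by (simp_all add: agree_def)
    have kr: "k < r" using k s by simp
    let ?Q = "\<lambda>s''. agree ?A s' s'' \<and> ?J (Suc k) s''"
    show "wp (test_common ;; clear_if_eq vAdj vX vCur ;; clear_if_eq vAdj vX vPrev ;;
       If vAdj {1} Skip (copy vNext vX ;; set_one vFound)) ?Q s'"
    proof (rule wp_Seq, rule wp_test_common)
      fix s1 assume s1: "bounded s1" "agree {0, 1, vJ, vAdj, 20, 21, 22} s' s1"
        "s1 vAdj \<noteq> 0 \<longleftrightarrow> (\<exists>j<c. M $$ (s' vCur, j) = 1 \<and> M $$ (s' vX, j) = 1)"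
      show "wp (clear_if_eq vAdj vX vCur ;; clear_if_eq vAdj vX vPrev ;;
         If vAdj {1} Skip (copy vNext vX ;; set_one vFound)) ?Q s1"
      proof (rule wp_Seq, rule wp_clear_if_eq)
        fix s2 assume s2: "bounded s2" "agree {1, 19, vDiff, vAdj} s1 s2"
          "s2 vAdj = (if s1 vX = s1 vCur then 0 else s1 vAdj)"
        show "wp (clear_if_eq vAdj vX vPrev ;;
           If vAdj {1} Skip (copy vNext vX ;; set_one vFound)) ?Q s2"
        proof (rule wp_Seq, rule wp_clear_if_eq)
          fix s3 assume s3: "bounded s3" "agree {1, 19, vDiff, vAdj} s2 s3"
            "s3 vAdj = (if s2 vX = s2 vPrev then 0 else s2 vAdj)"
          have "agree {0, 1, vJ, vAdj, vDiff, 19, 20, 21, 22} s' s2"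
            by (rule agree_trans[OF s1(2) s2(2)]) auto
          then have ag: "agree {0, 1, vJ, vAdj, vDiff, 19, 20, 21, 22} s' s3"
            by (rule agree_trans[OF _ s3(2)]) auto
          have v1: "s1 vX = k" "s1 vCur = s vCur" and v2: "s2 vX = k" "s2 vPrev = s vPrev"
            and v3: "s3 vX = k" "s3 vFound = s' vFound" "s3 vNext = s' vNext"
            using s1(2) s2(2) ag v s'(3) by (simp_all add: agree_def)
          have adj: "s3 vAdj \<noteq> 0 \<longleftrightarrow> E (s vCur) k \<and> k \<noteq> s vPrev"
            using s1(3) s2(3) s3(3) v1 v2 v s'(3) kr s(4) by (auto simp: row_adj_def)
          show "wp (If vAdj {1} Skip (copy vNext vX ;; set_one vFound)) ?Q s3"
          proof (rule wp_If_zero)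
            assume "s3 vAdj = 0"
            then have no: "\<not> (E (s vCur) k \<and> k \<noteq> s vPrev)" using adj by blast
            have "?J (Suc k) s3" using s'(4) no v3 by (auto simp: less_Suc_eq)
            moreover have "agree ?A s' s3" using ag by (auto simp: agree_def)
            ultimately show "wp Skip ?Q s3" by (intro wp_Skip) blast
          next
            assume "s3 vAdj \<noteq> 0"
            then have yes: "E (s vCur) k \<and> k \<noteq> s vPrev" using adj by blast
            have "agree ?A s' (s3(1 := 0, vNext := k, vFound := 1))" using ag by (auto simp: agree_def)
            with yes show "wp (copy vNext vX ;; set_one vFound) ?Q s3"
              using s3(1) v3 boundedD[OF s'(1)] boundedD[OF s3(1), of vX]
              by (intro wp_Seq wp_copy wp_set_one) (simp_all add: boundedD B_pos Suc_leI)
          qed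
        qed (use s2 in auto)
      qed (use s1 in auto)
    qed (use s' v kr s in auto)
  next
    fix s' assume s': "bounded s'" "agree (?A \<union> {1, 23, vX}) (s(vFound := 0)) s'"
      "?J ((s(vFound := 0)) vR) s'"
    have "agree find_moved s s'" using s'(2) by (auto simp: agree_def)
    moreover have "x < r" if "E (s vCur) x" for x using that by (simp add: row_adj_def)
    ultimately show "Q s'" using s' s by (intro Q) auto
  qed (use s in \<open>auto simp: bounded_upd program_defs\<close>)
  then show ?thesis
    unfolding find_next_def using s by (intro wp_Seq wp_zero) (simp_all add: boundedD)
qed

abbreviation step_moved :: "nat set" where
  "step_moved \<equiv> {vCur, vPrev, vOk} \<union> find_moved"

text \<open>The two continuations match the analysis of high walks: \<open>stuck\<close> serves
  \<open>high_walk_stuck\<close>, while \<open>step\<close> serves \<open>high_walk_Suc\<close> or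
  \<open>high_walk_below\<close>, according to whether the new row is below
  \<open>vI\<close>.\<close>

lemma wp_walk_step:
  assumes s: "bounded s" "s vR = r" "s vC = c" "s vCur < r"
    and stuck: "\<And>s'. bounded s' \<Longrightarrow> agree step_moved s s' \<Longrightarrow> (\<And>x. E (s vCur) x \<Longrightarrow> x = s vPrev) \<Longrightarrow>
      s' vOk = 0 \<Longrightarrow> s' vCur = s vCur \<Longrightarrow> Q s'"
    and step: "\<And>s'. bounded s' \<Longrightarrow> agree step_moved s s' \<Longrightarrow> E (s vCur) (s' vCur) \<Longrightarrow> s' vCur \<noteq> s vPrev \<Longrightarrow>
      s' vPrev = s vCur \<Longrightarrow> s' vOk = (if s' vCur < s vI then 0 else s vOk) \<Longrightarrow> Q s'"
  shows "wp walk_step Q s"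
  unfolding walk_step_def
proof (rule wp_Seq, rule wp_find_next[OF s])
  fix s1 assume s1: "bounded s1" "agree find_moved s s1"
    "s1 vFound = 0 \<longrightarrow> (\<forall>x. E (s vCur) x \<longrightarrow> x = s vPrev)"
    "s1 vFound \<noteq> 0 \<longrightarrow> E (s vCur) (s1 vNext) \<and> s1 vNext \<noteq> s vPrev"
  have v: "s1 vCur = s vCur" "s1 vI = s vI" "s1 vOk = s vOk"
    using s1(2) by (simp_all add: agree_def)
  have b: "s1 u \<le> B" "s1 u - s1 u' \<le> B" for u u' using boundedD[OF s1(1), of u] by auto
  show "wp (If vFound {1} (zero vOk)
     (copy vPrev vCur ;; copy vCur vNext ;; sub 19 vDiff vI vCur ;; If vDiff {1} Skip (zero vOk))) Q s1"
  proof (rule wp_If_zero)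
    assume "s1 vFound = 0"
    then show "wp (zero vOk) Q s1"
      using s1 v b boundedD[OF s(1)] by (intro wp_zero stuck) (auto simp: bounded_upd agree_def)
  next
    assume "s1 vFound \<noteq> 0"
    then have e: "E (s vCur) (s1 vNext)" "s1 vNext \<noteq> s vPrev" using s1(4) by auto
    define s2 where "s2 = s1(1 := 0, vPrev := s1 vCur, vCur := s1 vNext, 19 := 0, vDiff := s1 vI - s1 vNext)"
    have s2: "bounded s2" using s1(1) b by (simp add: s2_def bounded_upd)
    have ag: "agree step_moved s s2" using s1(2) by (simp add: agree_def s2_def)
    have "wp (If vDiff {1} Skip (zero vOk)) Q s2"
    proof (rule wp_If_zero)
      assume "s2 vDiff = 0"
      then have "\<not> s2 vCur < s vI" using v(2) by (simp add: s2_def)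
      then show "wp Skip Q s2"
        using s2 ag e v by (intro wp_Skip step) (simp_all add: s2_def)
    next
      assume "s2 vDiff \<noteq> 0"
      then have lt: "s2 vCur < s vI" using v(2) by (simp add: s2_def)
      have "bounded (s2(vOk := 0))" "agree step_moved s (s2(vOk := 0))"
        using s2 ag by (simp_all add: bounded_upd agree_upd)
      then show "wp (zero vOk) Q s2"
        using lt e v boundedD[OF s2, of vOk] by (intro wp_zero step) (simp_all add: s2_def)
    qed
    moreover have "s1(1 := 0, vPrev := s1 vCur, 1 := 0, vCur := s1 vNext, 1 := 0, 19 := 0,
        vDiff := s1 vI - s1 vNext) = s2"
      by (simp add: s2_def fun_eq_iff)
    ultimately show "wp (copy vPrev vCur ;; copy vCur vNext ;; sub 19 vDiff vI vCur ;;
        If vDiff {1} Skip (zero vOk)) Q s1"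
      using b by (intro wp_Seq wp_copy wp_sub) simp_all
  qed
qed

lemma wp_test_row:
  assumes s: "bounded s" "s vR = r" "s vC = c" "s vI < r" "s vCount < B"
    and Q: "\<And>s'. bounded s' \<Longrightarrow> agree ({vK, vCount, 24} \<union> step_moved) s s' \<Longrightarrow>
      s' vCount = (if s vI \<in> core_minima E then Suc (s vCount) else s vCount) \<Longrightarrow> Q s'"
  shows "wp test_row Q s"
proof -
  define s0 where "s0 = s(1 := 0, vCur := s vI, vPrev := s vI, vOk := 1)"
  have s0: "bounded s0" using s by (simp add: s0_def bounded_upd boundedD B_pos Suc_leI)
  \<comment> \<open>The bound on \<open>vCur\<close> is kept even after a failure, since the
    remaining rounds still look up entries in that row.\<close>
  let ?J = "\<lambda>k s'. s' vCur < r \<and> (s' vOk = 0 \<longrightarrow> s vI \<notin> core_minima E) \<and>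
    (s' vOk \<noteq> 0 \<longrightarrow> high_walk E (s vI) k (s' vPrev) (s' vCur))"
  have "wp (for_loop 24 vK vR walk_step) (wp (If vOk {1} Skip (inc vCount)) Q) s0"
  proof (rule wp_for[where A = step_moved and J = ?J])
    show "?J 0 s'" if "agree {1, 24, vK} s0 s'" for s'
      using agreeD[OF that, of vCur] agreeD[OF that, of vPrev] agreeD[OF that, of vOk] s
      by (simp add: s0_def high_walk_0)
  next
    fix k s' assume k: "k < s0 vR" and s': "bounded s'" "agree (step_moved \<union> {1, 24, vK}) s0 s'"
      "s' vK = k" "?J k s'"
    have v: "s' vR = r" "s' vC = c" "s' vI = s vI"
      using s'(2) s by (simp_all add: agree_def s0_def)
    show "wp walk_step (\<lambda>s''. agree step_moved s' s'' \<and> ?J (Suc k) s'') s'"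
    proof (rule wp_walk_step)
      fix s'' assume s'': "agree step_moved s' s''" "\<And>x. E (s' vCur) x \<Longrightarrow> x = s' vPrev" "s'' vOk = 0"
        "s'' vCur = s' vCur"
      have "s vI \<notin> core_minima E"
        using s'(4) high_walk_stuck[of E "s vI" k "s' vPrev" "s' vCur"] s''(2) by blast
      then show "agree step_moved s' s'' \<and> ?J (Suc k) s''" using s'' s'(4) by auto
    next
      fix s'' assume s'': "agree step_moved s' s''" "E (s' vCur) (s'' vCur)" "s'' vCur \<noteq> s' vPrev"
        "s'' vPrev = s' vCur" "s'' vOk = (if s'' vCur < s' vI then 0 else s' vOk)"
      have lt: "s'' vCur < r" using s''(2) by (simp add: row_adj_def)
      have "s vI \<notin> core_minima E" if "s'' vOk = 0"
      proof (cases "s' vOk = 0")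
        case False
        then have "s'' vCur < s vI" using that s''(5) v(3) by (simp split: if_splits)
        moreover have "high_walk E (s vI) k (s' vPrev) (s' vCur)" using False s'(4) by blast
        ultimately show ?thesis using s''(2) high_walk_below by blast
      qed (use s'(4) in blast)
      moreover have "high_walk E (s vI) (Suc k) (s'' vPrev) (s'' vCur)" if "s'' vOk \<noteq> 0"
      proof -
        have "s' vOk \<noteq> 0" "s vI \<le> s'' vCur" using that s''(5) v(3) by (auto split: if_splits)
        then show ?thesis using s'(4) s''(2,3,4) high_walk_Suc by metis
      qed
      ultimately show "agree step_moved s' s'' \<and> ?J (Suc k) s''" using s''(1) lt by blast
    qed (use s' v in auto)
  next
    fix s' assume s': "bounded s'" "agree (step_moved \<union> {1, 24, vK}) s0 s'" "?J (s0 vR) s'"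
    have "s0 vR = r" using s by (simp add: s0_def)
    \<comment> \<open>The walk has made \<open>r\<close> steps among \<open>r\<close> rows, enough
      for a repetition; \<open>0 < r\<close> holds because \<open>s vI\<close> is a row.\<close>
    then have "s' vOk \<noteq> 0 \<Longrightarrow> s vI \<in> core_minima E"
      using s'(3) s(4) high_walk_long[OF finite_lessThan row_adj_sym row_adj_irrefl row_adj_dim
          card_row_adj[OF M], where n = r] by auto
    then have iff: "s vI \<in> core_minima E \<longleftrightarrow> s' vOk \<noteq> 0" using s'(3) by blast
    have cnt: "s' vCount = s vCount" using s'(2) by (simp add: agree_def s0_def)
    have ag: "agree ({vK, vCount, 24} \<union> step_moved) s s'" using s'(2) by (simp add: agree_def s0_def)
    show "wp (If vOk {1} Skip (inc vCount)) Q s'"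
      using iff cnt ag s'(1) s(5)
      by (intro wp_If_zero wp_Skip wp_inc Q) (auto simp: bounded_upd agree_upd)
  qed (use s0 in \<open>auto simp: program_defs\<close>)
  moreover have "s(1 := 0, vCur := s vI, 1 := 0, vPrev := s vI, vOk := 1) = s0"
    by (auto simp: s0_def fun_eq_iff)
  ultimately show ?thesis
    unfolding test_row_def using s
    by (intro wp_Seq wp_copy wp_set_one) (simp_all add: boundedD B_pos Suc_leI)
qed

lemma wp_count_and_compare:
  "wp count_and_compare (\<lambda>s. (s vCount = 0 \<and> s vLe \<noteq> 0) = SC1S_R d M) (\<lambda>_. 0)"
proof -
  define s0 :: "nat \<Rightarrow> nat" where "s0 = (\<lambda>_. 0)(vR := r, vC := c, 0 := r + 2 + c)"
  let ?C = "\<lambda>k. card (core_minima E \<inter> {..<k})"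
  let ?A = "{vK, vCount, 24} \<union> step_moved"
  let ?Q = "\<lambda>s. (s vCount = 0 \<and> s vLe \<noteq> 0) = SC1S_R d M"
  have s0: "bounded s0" unfolding s0_def bounded_def using B_eq by auto
  have "wp (for_loop 25 vI vR test_row) (wp (zero vJ ;; lookup vR vJ ;; compare) ?Q) s0"
  proof (rule wp_for[where A = ?A and J = "\<lambda>k s. s vCount = ?C k"])
    show "s' vCount = ?C 0" if "agree {1, 25, vI} s0 s'" for s'
      using agreeD[OF that, of vCount] by (simp add: s0_def)
  next
    fix k s' assume k: "k < s0 vR" and s': "bounded s'" "agree (?A \<union> {1, 25, vI}) s0 s'" "s' vI = k"
      "s' vCount = ?C k"
    \<comment> \<open>At most one cycle is counted per row tested, which keeps the counter within
      the space bound.\<close>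
    have "?C k \<le> card {..<k}" by (intro card_mono) auto
    then have lt: "s' vCount < B" using s'(4) k by (simp add: s0_def B_eq)
    show "wp test_row (\<lambda>s''. agree ?A s' s'' \<and> s'' vCount = ?C (Suc k)) s'"
    proof (rule wp_test_row)
      fix s'' assume "agree ?A s' s''"
        "s'' vCount = (if s' vI \<in> core_minima E then Suc (s' vCount) else s' vCount)"
      then show "agree ?A s' s'' \<and> s'' vCount = ?C (Suc k)"
        using s'(3,4) by (simp add: lessThan_Suc Int_insert_right)
    qed (use s' k lt in \<open>simp_all add: agree_def s0_def\<close>)
  next
    fix s' assume s': "bounded s'" "agree (?A \<union> {1, 25, vI}) s0 s'" "s' vCount = ?C (s0 vR)"
    have "core_minima E \<inter> {..<r} = core_minima E"
      using core_minima_subset[of E "{..<r}"] row_adj_dim by blast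
    then have cnt: "s' vCount = card (core_minima E)" using s'(3) by (simp add: s0_def)
    have v: "s' vR = r" "s' vC = c" using s'(2) by (simp_all add: agree_def s0_def)
    have le: "3 + r + c + r * c \<le> B" by (simp add: B_eq)
    show "wp (zero vJ ;; lookup vR vJ ;; compare) ?Q s'"
    proof (rule wp_Seq, rule wp_zero, rule boundedD[OF s'(1)], rule wp_Seq, rule wp_lookup)
      fix s'' assume s'': "bounded s''" "agree {0, 1, 20, 21} (s'(vJ := 0)) s''"
        "s'' 0 = 3 + (s'(vJ := 0)) vR + (s'(vJ := 0)) vC + (s'(vJ := 0)) vR * (s'(vJ := 0)) vC + (s'(vJ := 0)) vJ"
      have "s'' vCount = card (core_minima E)" using s''(2) cnt by (simp add: agree_def)
      then show "wp compare ?Q s''"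
        using s'' v SC1S_R_iff_card_core_minima[OF M, of d] by (intro wp_compare) simp_all
    qed (use s' v le in \<open>simp_all add: bounded_upd\<close>)
  qed (use s0 in \<open>auto simp: program_defs\<close>)
  then show ?thesis
    unfolding count_and_compare_def by (intro wp_Seq wp_read_dims) (simp add: s0_def)
qed

text \<open>\<open>Halt\<close> has no big-step derivation, so the final branching is executed by
  single steps after the verified part.\<close>

lemma decide_run: "\<exists>s. small\<^sup>*\<^sup>* (decide, \<lambda>_. 0) (Halt (SC1S_R d M), s)"
proof -
  let ?rest = "If vCount {1} (If vLe {1} (Halt False) (Halt True)) (Halt False)"
  obtain s where run: "big count_and_compare (\<lambda>_. 0) s"
    and yes: "(s vCount = 0 \<and> s vLe \<noteq> 0) = SC1S_R d M"
    using wp_count_and_compare by (auto simp: wp_def)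
  have "bounded (\<lambda>_. 0)" by (simp add: bounded_def)
  with big_small[OF run] have 1: "small\<^sup>*\<^sup>* (count_and_compare, \<lambda>_. 0) (Skip, s)" and s: "bounded s" by auto
  have "small\<^sup>*\<^sup>* (decide, \<lambda>_. 0) (Skip ;; ?rest, s)"
    unfolding decide_def by (rule small_Seq[OF 1])
  moreover have "small (Skip ;; ?rest, s) (?rest, s)" by (rule small_stay[OF s]) simp
  moreover have "small\<^sup>*\<^sup>* (?rest, s) (Halt (SC1S_R d M), s)"
  proof (cases "s vCount = 0")
    case True
    then have "small (?rest, s) (If vLe {1} (Halt False) (Halt True), s)"
      using sym_one_iff[where s = s and t = vCount] by (intro small_stay[OF s]) simp
    moreover have "small (If vLe {1} (Halt False) (Halt True), s) (Halt (SC1S_R d M), s)"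
      using yes True sym_one_iff[where s = s and t = vLe] by (intro small_stay[OF s]) auto
    ultimately show ?thesis by (meson converse_rtranclp_into_rtranclp r_into_rtranclp)
  next
    case False
    then have "small (?rest, s) (Halt (SC1S_R d M), s)"
      using yes sym_one_iff[where s = s and t = vCount] by (intro small_stay[OF s]) auto
    then show ?thesis by (rule r_into_rtranclp)
  qed
  ultimately show ?thesis
    by (meson converse_rtranclp_into_rtranclp rtranclp_trans)
qed

end

theorem theorem4:
  shows "poly_time_solvable {(M, d). xy_matrix 2 2 M} encode_instance (\<lambda>(M, d). SC1S_R d M)"
\<comment> \<open>The tapes used are numbered up to 25, and \<open>b = 1\<close> grants the blank
  cell behind the input.\<close>
proof (rule poly_time_solvable_by_com[where c = decide and k = 26 and b = 1])
  fix x :: "nat mat \<times> nat" assume "x \<in> {(M, d). xy_matrix 2 2 M}"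
  then obtain M d where x: "x = (M, d)" and M: "xy_matrix 2 2 M" by auto
  interpret sc1s_run "encode_instance x" "length (encode_instance x) + 1" M d
    by unfold_locales (simp_all add: M x)
  show "\<exists>s. (tape_run.small (encode_instance x) (length (encode_instance x) + 1))\<^sup>*\<^sup>*
      (decide, \<lambda>_. 0) (Halt (case x of (M, d) \<Rightarrow> SC1S_R d M), s)"
    using decide_run by (simp add: x)
qed (simp_all add: tapes_decide Halt_decide)

end
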